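(* Let $G$ be a group that is generated as a semigroup by the finite set $\mathcal{G}$, and suppose that, for each $n \ge 0$, there are subsets $S_1(n), S_2(n)$ of $G$ satisfying the following conditions. (1) For each $n\ge 0$ and $i\in\{1,2\}$, each element of $S_i(n)$ can be represented by a word over $\mathcal{G}$ of length at most $n$. (2) There are constants $\alpha_0>0$, $\alpha_1>1$, $\alpha_2>0$ such that for all sufficiently large $n$, $|S_1(n)| \geq \alpha_0\alpha_1^n$ and $|S_2(n)| \geq \alpha_2 n$. (3) For each $n \ge 0$, each element of $S_1(n)$ commutes with each element of $S_2(n)$. Then $G$ does not have a non-deterministic Cannon's algorithm over any finite semigroup generating set of $G$.
   Context: For a finite set $A$, $A^*$ denotes the set of all words over $A$, including the empty word $\epsilon$, and $|w|$ denotes the length of a word $w$. A non-deterministic Cannon's algorithm (NCA) is a triple $(X,\mathbb{A},\mathcal{R})$, where $X\subseteq \mathbb{A}$ are finite alphabets and $\mathcal{R}$ is a finite set of rules of the form $v\rightarrow u$ with $u,v\in \mathbb{A}^*$ and $|v|>|u|$. Distinct rules are allowed to have the same left hand side. Some of the rules may be anchored on the left, on the right, or on both sides. A non-anchored rule $v \rightarrow u$ may be applied to any occurrence of $v$ as a subword, replacing that occurrence by $u$ (so $w_1vw_2$ is replaced by $w_1uw_2$ for any $w_1,w_2\in\mathbb{A}^*$). A rule $v \rightarrow u$ anchored on the left, on the right, or on both sides may be applied only to the indicated subword $v$ in words of the form $vw$, $wv$, or $v$, respectively, with $w\in\mathbb{A}^*$ (giving $uw$, $wu$, or $u$). Write $w\rightarrow^*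 w'$ if $w'$ can be obtained from $w$ by a finite sequence (possibly empty) of rule applications. The language of the NCA is the set of words $w\in X^*$ with $w\rightarrow^*\epsilon$. If a group $G$ is generated as a semigroup by a finite set $X$, the word problem of $G$ over $X$ is the set of words in $X^*$ that represent the identity element of $G$ (including $\epsilon$). $G$ has a non-deterministic Cannon's algorithm over $X$ if there is an NCA $(X,\mathbb{A},\mathcal{R})$, for some finite alphabet $\mathbb{A}\supseteq X$, whose language is the word problem of $G$ over $X$. *)

theory Defs
  imports Complex_Main "HOL-Algebra.Group"
begin

datatype 'b rule =
  Rule (lhs: "'b list") (rhs: "'b list") (anchored_left: bool) (anchored_right: bool)

locale nca =
  fixes X :: "'b set" and A :: "'b set" and R :: "'b rule set"
  assumes finite_alphabet: "finite A"
    and input_subset: "X \<subseteq> A"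
    and finite_rules: "finite R"
    and rule_words: "\<And>\<rho>. \<rho> \<in> R \<Longrightarrow> lhs \<rho> \<in> lists A \<and> rhs \<rho> \<in> lists A"
    and length_reducing: "\<And>\<rho>. \<rho> \<in> R \<Longrightarrow> length (rhs \<rho>) < length (lhs \<rho>)"

text \<open>An anchor forces the context on its side to be empty; a rule anchored on both
  sides rewrites only the whole word. The contexts need not be restricted to words over the
  working alphabet, since rewriting a word over that alphabet never leaves it.\<close>

inductive nca_step :: "'b rule set \<Rightarrow> 'b list \<Rightarrow> 'b list \<Rightarrow> bool" for R where
  "\<rho> \<in> R \<Longrightarrow> (anchored_left \<rho> \<longrightarrow> w1 = []) \<Longrightarrow> (anchored_right \<rho> \<longrightarrow> w2 = [])
    \<Longrightarrow> nca_step R (w1 @ lhs \<rho> @ w2) (w1 @ rhs \<rho> @ w2)"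

definition nca_language :: "'b set \<Rightarrow> 'b rule set \<Rightarrow> 'b list set" where
  "nca_language X R = {w \<in> lists X. (nca_step R)\<^sup>*\<^sup>* w []}"

definition word_value :: "('a, 'm) monoid_scheme \<Rightarrow> 'a list \<Rightarrow> 'a" where
  "word_value G w = foldr (\<lambda>x y. x \<otimes>\<^bsub>G\<^esub> y) w \<one>\<^bsub>G\<^esub>"

text \<open>Generation as a semigroup uses nonempty products only.\<close>

definition semigroup_generates :: "('a, 'm) monoid_scheme \<Rightarrow> 'a set \<Rightarrow> bool" where
  "semigroup_generates G X \<longleftrightarrow>
     X \<subseteq> carrier G \<and> (\<forall>g \<in> carrier G. \<exists>w \<in> lists X. w \<noteq> [] \<and> word_value G w = g)"

definition word_problem :: "('a, 'm) monoid_scheme \<Rightarrow> 'a set \<Rightarrow> 'a list set" where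
  "word_problem G X = {w \<in> lists X. word_value G w = \<one>\<^bsub>G\<^esub>}"

text \<open>The working alphabet may contain arbitrarily many symbols outside the group. Taking it
  inside \<^typ>\<open>'a + nat\<close>, with a generator \<open>x\<close> appearing as \<open>Inl x\<close>, loses no
  generality: any finite superset of \<open>X\<close> is, up to renaming the symbols outside \<open>X\<close>,
  of the form \<open>Inl ` X \<union> Inr ` {..<k}\<close>.\<close>

definition has_nca_over :: "('a, 'm) monoid_scheme \<Rightarrow> 'a set \<Rightarrow> bool" where
  "has_nca_over G X \<longleftrightarrow>
     (\<exists>(A :: ('a + nat) set) R. nca (Inl ` X) A R \<and>
        nca_language (Inl ` X) R = map Inl ` word_problem G X)"

end

theory Submission
  imports Defs
begin

text \<open>Suppose that a length-reducing system solves the word problem. Take \<open>g\<close> in \<open>S1 n\<close>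
  and \<open>h\<close> in a subset \<open>H\<close> of \<open>S2 n\<close> of size about \<open>\<alpha>\<^sub>2 n\<close>, and follow the reduction of the
  commutator word \<open>u v ubar vbar\<close> to the empty word, where \<open>u\<close>, \<open>v\<close>, \<open>ubar\<close>, \<open>vbar\<close> spell \<open>g\<close>,
  \<open>h\<close> and their inverses. The idea is that such reductions carry too little information across
  cuts of the word: they let \<open>g\<close> be reconstructed from so little data that \<open>S1 n\<close> cannot have
  exponential size.

  Each letter of a later word is traced back to one letter of the input: the letters produced by
  a rule descend from a letter of the left hand side whose history is shortest. Two derivations
  that contain a letter with the same history can be cut along it and spliced
  (\<open>splice_at_letter\<close>). Splicing at two letters shows that the group element spelled by the
  input between their origins depends only on the two histories and on the symbols
  that currently stand between the letters (\<open>slices_equal\<close>). Since rules shorten words and every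
  letter of the left hand side has a history at least as long as the chosen one, the number of
  letters that ever acquire a history of length at least \<open>j\<close> decays geometrically in \<open>j\<close>
  (\<open>few_old_letters\<close>). So all histories have length \<open>O(log n)\<close>, and the set \<open>pieces\<close> of elements
  that occur between nearby letters, together with the prefixes of the words for the elements
  of \<open>H\<close> and for their inverses, has polynomial size.

  Let \<open>\<xi>\<close> be the value of the input before the origin of the last letter that comes from \<open>u\<close>.
  As long as letters from both \<open>u\<close> and \<open>ubar\<close> survive, each step multiplies \<open>\<xi>\<close> by at most one
  piece or its inverse; at the start \<open>\<xi>\<close> is a few pieces away from \<open>g\<close>, and at the end
  a few pieces away from the identity (\<open>xi_step\<close>, \<open>start_time_near\<close>, \<open>xi_end\<close>). The walk may have linearly many steps,
  so it has to be shortened. The times are coloured so that \<open>\<xi>\<close> moves by boundedly many pieces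
  between times of the same colour; then the whole walk is replaced by one of length
  proportional to the number of colours (\<open>near_along_colours\<close>).

  The colours come from the two letters at the boundary, while this lies between a letter from
  \<open>u\<close> and one from \<open>ubar\<close>. A letter with a history of length at least \<open>j\<close> is itself a colour,
  and there are few of these. Otherwise the colour depends on the key of the time: the origin
  of the left letter and the symbols and histories of both letters. A key determines the product
  \<open>\<eta> = g h p\<close>, where \<open>p\<close> is the prefix of \<open>ubar\<close> before the origin of the right letter, so
  different \<open>h\<close> that meet the same key do so at different positions of \<open>ubar\<close>. If few \<open>h\<close> meet
  a key, the key is poor; double counting gives an \<open>h\<close> that meets few poor keys. If at least
  \<open>m\<close> of them do, the key occupies at least \<open>m\<close> positions of \<open>ubar\<close>, so at most \<open>|ubar| / m\<close>
  rich keys have disjoint sets of positions, and two keys that share a position have values of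
  \<open>\<eta>\<close> that differ by two elements of \<open>H\<close>. Besides making the commutator word trivial,
  commutation enters in this last claim, where it turns \<open>g h p\<close> into \<open>h g p\<close>.

  With \<open>n\<close> a large power \<open>D\<^sup>4\<^sup>j\<close> and \<open>m = D\<^sup>2\<^sup>j\<close>, the number of colours is at most a
  constant times \<open>r\<^sup>j n\<close> for some \<open>r < 1\<close>, while the logarithm of the number of pieces is
  \<open>O(j)\<close> (\<open>log_card_bound\<close>). Hence \<open>ln |S1 n| = o(n)\<close> along these \<open>n\<close>, against the exponential
  lower bound.\<close>

section \<open>Lists, functional relations and disjoint families\<close>

lemma card_lists_le:
  assumes "finite B"
  shows "finite {xs. set xs \<subseteq> B \<and> length xs \<le> k}"
    and "card {xs. set xs \<subseteq> B \<and> length xs \<le> k} \<le> Suc (card B) ^ k"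
proof -
  show "finite {xs. set xs \<subseteq> B \<and> length xs \<le> k}" using assms by (rule finite_lists_length_le)
  have "(\<Sum>i\<le>k. c ^ i) \<le> Suc c ^ k" for c :: nat
  proof (induction k)
    case (Suc k)
    have "c ^ Suc k \<le> c * Suc c ^ k" by (simp add: power_mono)
    from add_mono[OF Suc this] show ?case by simp
  qed simp
  then show "card {xs. set xs \<subseteq> B \<and> length xs \<le> k} \<le> Suc (card B) ^ k"
    by (simp add: card_lists_length_le[OF assms])
qed

text \<open>The form in which the bounds on gaps, ends and visitors arise below: each element of \<open>S\<close> is described by
some datum from \<open>D\<close>, and a datum describes at most one element.\<close>

lemma card_le_of_functional:
  assumes "finite D" "\<And>e. e \<in> S \<Longrightarrow> \<exists>d\<in>D. rel d e"
    and "\<And>d e e'. rel d e \<Longrightarrow> rel d e' \<Longrightarrow> e = e'"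
  shows "finite S" "card S \<le> card D"
proof -
  obtain f where f: "\<And>e. e \<in> S \<Longrightarrow> f e \<in> D \<and> rel (f e) e" using assms(2) by metis
  then have "inj_on f S" using assms(3) by (metis inj_onI)
  moreover have "f ` S \<subseteq> D" using f by auto
  ultimately show "finite S" "card S \<le> card D"
    using assms(1) by (auto intro: inj_on_finite card_inj_on_le)
qed

text \<open>A maximal subfamily of pairwise disjoint members meets every member, and disjointness
bounds its size.\<close>

lemma disjoint_centres:
  fixes I :: "'k \<Rightarrow> nat set"
  assumes "finite K" "\<And>k. k \<in> K \<Longrightarrow> I k \<subseteq> {..<N} \<and> m \<le> card (I k)" "m > 0"
  obtains C where "C \<subseteq> K" "card C * m \<le> N" "\<forall>k\<in>K. \<exists>c\<in>C. I k \<inter> I c \<noteq> {}"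
proof -
  define F where "F = {C. C \<subseteq> K \<and> (\<forall>i\<in>C. \<forall>j\<in>C. i \<noteq> j \<longrightarrow> I i \<inter> I j = {})}"
  have "finite F" using assms(1) by (simp add: F_def)
  moreover have "{} \<in> F" by (simp add: F_def)
  ultimately obtain C where C: "C \<in> F" "\<And>D. D \<in> F \<Longrightarrow> C \<subseteq> D \<Longrightarrow> C = D"
    using finite_has_maximal[of F] by blast
  have finC: "finite C" using C(1) assms(1) finite_subset by (auto simp: F_def)
  have "card C * m \<le> (\<Sum>c\<in>C. card (I c))"
    using sum_bounded_below[of C m "\<lambda>c. card (I c)"] assms(2) C(1) by (auto simp: F_def)
  also have "\<dots> = card (\<Union>c\<in>C. I c)"
    using C(1) assms(2) finC
    by (intro card_UN_disjoint[symmetric])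
      (auto simp: F_def intro: finite_subset)
  also have "\<dots> \<le> card {..<N}"
    using C(1) assms(2) by (intro card_mono) (auto simp: F_def)
  finally have "card C * m \<le> N" by simp
  moreover have "\<exists>c\<in>C. I k \<inter> I c \<noteq> {}" if k: "k \<in> K" for k
  proof (rule ccontr)
    assume none: "\<not> ?thesis"
    then have "insert k C \<in> F" using C(1) k by (auto simp: F_def Int_commute)
    then have "k \<in> C" using C(2) by blast
    moreover have "I k \<noteq> {}" using assms(2)[OF k] assms(3) by auto
    ultimately show False using none by auto
  qed
  ultimately show thesis using that C(1) by (auto simp: F_def)
qed

section \<open>Rewriting with traced letters\<close>

text \<open>An entry \<open>(\<rho>, i, j)\<close> of a history says that the letter was created as the \<open>j\<close>-th letter of the
right hand side of \<open>\<rho>\<close> and that its parent was the \<open>i\<close>-th letter of the left hand side; the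
most recent entry comes first.\<close>

datatype 'b tletter =
  Traced (orig: nat) (letter: 'b) (hist: "('b rule \<times> nat \<times> nat) list")

definition offspring :: "'b rule \<Rightarrow> nat \<Rightarrow> 'b tletter \<Rightarrow> 'b tletter list" where
  "offspring \<rho> i x =
     map (\<lambda>j. Traced (orig x) (rhs \<rho> ! j) ((\<rho>, i, j) # hist x)) [0..<length (rhs \<rho>)]"

text \<open>The parent of all new letters is a letter of the left hand side with a shortest history. This
choice is what keeps histories logarithmic: a letter with a history of length \<open>j + 1\<close> can be
created only by consuming nothing but letters with histories of length at least \<open>j\<close>.\<close>

inductive tstep :: "'b rule set \<Rightarrow> 'b tletter list \<Rightarrow> 'b tletter list \<Rightarrow> bool" for R where
  tstepI: "\<rho> \<in> R \<Longrightarrow> (anchored_left \<rho> \<longrightarrow> P = []) \<Longrightarrow> (anchored_right \<rho> \<longrightarrow> Q = []) \<Longrightarrow>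
    map letter L = lhs \<rho> \<Longrightarrow> i < length L \<Longrightarrow>
    (\<forall>y \<in> set L. length (hist (L ! i)) \<le> length (hist y)) \<Longrightarrow>
    tstep R (P @ L @ Q) (P @ offspring \<rho> i (L ! i) @ Q)"

text \<open>At the beginning, the origin of a letter is its position and its history is empty.\<close>

definition start :: "'b list \<Rightarrow> 'b tletter list" where
  "start w = map (\<lambda>k. Traced k (w ! k) []) [0..<length w]"

lemma length_offspring [simp]: "length (offspring \<rho> i x) = length (rhs \<rho>)"
  by (simp add: offspring_def)

lemma nth_offspring [simp]:
  "j < length (rhs \<rho>) \<Longrightarrow>
     offspring \<rho> i x ! j = Traced (orig x) (rhs \<rho> ! j) ((\<rho>, i, j) # hist x)"
  by (simp add: offspring_def)

lemma map_letter_offspring [simp]: "map letter (offspring \<rho> i x) = rhs \<rho>"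
  by (simp add: offspring_def comp_def map_nth)

lemma orig_offspring: "y \<in> set (offspring \<rho> i x) \<Longrightarrow> orig y = orig x"
  by (auto simp: offspring_def)

lemma length_start [simp]: "length (start w) = length w"
  by (simp add: start_def)

lemma nth_start [simp]: "k < length w \<Longrightarrow> start w ! k = Traced k (w ! k) []"
  by (simp add: start_def)

lemma map_letter_start [simp]: "map letter (start w) = w"
  by (simp add: start_def comp_def map_nth)

lemma hist_start: "y \<in> set (start w) \<Longrightarrow> hist y = []"
  by (auto simp: start_def)

lemma tstep_imp_nca_step: "tstep R Z Z' \<Longrightarrow> nca_step R (map letter Z) (map letter Z')"
  by (induction rule: tstep.induct) (auto intro: nca_step.intros)

lemma tsteps_imp_nca_steps:
  "(tstep R)\<^sup>*\<^sup>* Z Z' \<Longrightarrow> (nca_step R)\<^sup>*\<^sup>* (map letter Z) (map letter Z')"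
  by (induction rule: rtranclp_induct) (auto dest: tstep_imp_nca_step intro: rtranclp.rtrancl_into_rtrancl)

lemma (in nca) trace_step:
  assumes "nca_step R (map letter Z) w'"
  obtains Z' where "tstep R Z Z'" "map letter Z' = w'"
proof -
  from assms obtain \<rho> w1 w2 where r: "\<rho> \<in> R" "anchored_left \<rho> \<longrightarrow> w1 = []" "anchored_right \<rho> \<longrightarrow> w2 = []"
    and Z: "map letter Z = w1 @ lhs \<rho> @ w2" and w': "w' = w1 @ rhs \<rho> @ w2"
    by cases (metis that)
  from Z obtain P L Q where PLQ: "Z = P @ L @ Q" "map letter P = w1" "map letter L = lhs \<rho>" "map letter Q = w2"
    by (metis map_eq_append_conv)
  have "L \<noteq> []"
    using PLQ(3) length_reducing[OF r(1)] by auto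
  then obtain y where y: "y \<in> set L" "\<forall>z \<in> set L. length (hist y) \<le> length (hist z)"
    using ex_has_least_nat[of "\<lambda>y. y \<in> set L" _ "\<lambda>y. length (hist y)"]
    by (metis last_in_set)
  then obtain i where i: "i < length L" "L ! i = y"
    by (auto simp: in_set_conv_nth)
  have "tstep R (P @ L @ Q) (P @ offspring \<rho> i (L ! i) @ Q)"
    using r PLQ y i by (intro tstepI) auto
  then show thesis
    using that PLQ w' by simp
qed

lemma (in nca) trace_derivation:
  assumes "(nca_step R)\<^sup>*\<^sup>* w w'"
  obtains Z where "(tstep R)\<^sup>*\<^sup>* (start w) Z" "map letter Z = w'"
  using assms
proof (induction arbitrary: thesis rule: rtranclp_induct)
  case base
  then show ?case by (metis map_letter_start rtranclp.rtrancl_refl)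
next
  case (step y z)
  obtain Z where Z: "(tstep R)\<^sup>*\<^sup>* (start w) Z" "map letter Z = y"
    using step.IH by blast
  then obtain Z' where "tstep R Z Z'" "map letter Z' = z"
    using step.hyps trace_step by blast
  then show ?case
    using Z step.prems(1)[of Z'] by (metis rtranclp.rtrancl_into_rtrancl)
qed

section \<open>Splicing two derivations at a letter with a common history\<close>

text \<open>Seen from a fixed letter \<open>x\<close> of the result, a step acts on its left, on its right, or creates it.
In the first two cases the step does not see the other side of \<open>x\<close>, so this side may be
replaced; an anchor towards \<open>x\<close> is impossible because \<open>x\<close> is in the way.\<close>

lemma tstep_around_letter:
  assumes "tstep R Z (P @ x # Q)"
  obtains
    (left) P' where "Z = P' @ x # Q" "\<And>Q'. tstep R (P' @ x # Q') (P @ x # Q')"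
  | (right) Q' where "Z = P @ x # Q'"
  "\<And>P'. tstep R (P' @ x # Q') (P' @ x # Q)"
  | (born) \<rho> i j P0 L Q0 where "Z = P0 @ L @ Q0" "\<rho> \<in> R"
      "anchored_left \<rho> \<longrightarrow> P0 = []" "anchored_right \<rho> \<longrightarrow> Q0 = []"
      "map letter L = lhs \<rho>" "i < length L"
      "\<forall>y \<in> set L. length (hist (L ! i)) \<le> length (hist y)"
      "j < length (rhs \<rho>)" "x = Traced (orig (L ! i)) (rhs \<rho> ! j) ((\<rho>, i, j) # hist (L ! i))"
      "P = P0 @ take j (offspring \<rho> i (L ! i))" "Q = drop (Suc j) (offspring \<rho> i (L ! i)) @ Q0"
  using assms
proof cases
  case (tstepI \<rho> P0 Q0 L i)
  let ?O = "offspring \<rho> i (L ! i)"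
  have eq: "P @ x # Q = P0 @ ?O @ Q0" by (simp add: tstepI)
  consider (a) "length P < length P0"
    | (b) "length P0 \<le> length P" "length P < length P0 + length ?O"
    | (c) "length P0 + length ?O \<le> length P"
    by linarith
  then show thesis
  proof cases
    case a
    then obtain K where K: "P0 = P @ x # K" "Q = K @ ?O @ Q0"
      using eq by (auto simp: append_eq_append_conv2 Cons_eq_append_conv)
    have "tstep R (P' @ x # K @ L @ Q0) (P' @ x # Q)" for P'
      using tstep.tstepI[of \<rho> R "P' @ x # K" Q0 L i] tstepI K by auto
    then show thesis
      using right[of "K @ L @ Q0"] K tstepI by simp
  next
    case b
    define j where "j = length P - length P0"
    have j: "j < length (rhs \<rho>)" using b by (simp add: j_def)
    have P: "P = P0 @ take j ?O"
      using arg_cong[OF eq, of "take (length P)"] b by (simp add: j_def)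
    have "x # Q = drop j ?O @ Q0"
      using arg_cong[OF eq, of "drop (length P)"] b by (simp add: j_def)
    also have "drop j ?O = ?O ! j # drop (Suc j) ?O"
      using j by (metis Cons_nth_drop_Suc length_offspring)
    finally show thesis
      using born[of P0 L Q0 \<rho> i j] tstepI P j by simp
  next
    case c
    have "take (length P0 + length ?O) P = P0 @ ?O"
      using arg_cong[OF eq, of "take (length P0 + length ?O)"] c by simp
    then obtain K where K: "P = P0 @ ?O @ K"
      by (metis append.assoc append_take_drop_id)
    then have Q0: "Q0 = K @ x # Q" using eq by simp
    then have "\<not> anchored_right \<rho>" using tstepI by auto
    then have "tstep R ((P0 @ L @ K) @ x # Q') (P @ x # Q')" for Q'
      using tstep.tstepI[of \<rho> R P0 "K @ x # Q'" L i] tstepI K by auto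
    then show thesis
      using left[of "P0 @ L @ K"] tstepI Q0 by simp
  qed
qed

text \<open>The left half of the first derivation and the right half of the second one can be run side by
side. Steps that do not create the letter \<open>x\<close> belong to one half. When both derivations create
\<open>x\<close>, equality of histories says that they apply the same rule at the same place to the same
parent, so the left part of the left hand side found in the first derivation fits the right part
found in the second.\<close>

lemma splice_at_letter:
  assumes "(tstep R ^^ n1) Z1 (P1 @ x # Q1)" "(tstep R ^^ n2) Z2 (P2 @ x # Q2)"
    and "\<forall>y \<in> set Z1. hist y = []" "\<forall>y \<in> set Z2. hist y = []"
  shows "\<exists>l1 a r1 l2 r2. Z1 = l1 @ a # r1 \<and> Z2 = l2 @ a # r2 \<and> orig a = orig x \<and>
           (tstep R)\<^sup>*\<^sup>* (l1 @ a # r2) (P1 @ x # Q2)"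
  using assms(1,2)
proof (induction "n1 + n2" arbitrary: n1 n2 P1 P2 Q1 Q2 x rule: less_induct)
  case less
  show ?case
  proof (cases n1)
    case 0
    then have Z1: "Z1 = P1 @ x # Q1" using less.prems by simp
    show ?thesis
    proof (cases n2)
      case 0
      then have "Z2 = P2 @ x # Q2" using less.prems by simp
      then show ?thesis using Z1 by blast
    next
      case (Suc k)
      then obtain Y where Y: "(tstep R ^^ k) Z2 Y" "tstep R Y (P2 @ x # Q2)"
        using less.prems by (auto elim: relpowp_Suc_E)
      from Y(2) show ?thesis
      proof (cases rule: tstep_around_letter)
        case (left P')
        then show ?thesis using less.hyps[of n1 k P1 x Q1 P' Q2] less.prems Y Suc by auto
      next
        case (right Q')
        then show ?thesis using less.hyps[of n1 k P1 x Q1 P2 Q'] less.prems Y Suc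
          by (metis add_Suc_right lessI rtranclp.rtrancl_into_rtrancl)
      next
        case born
        then show ?thesis using assms(3) Z1 by auto
      qed
    qed
  next
    case (Suc k1)
    then obtain Y1 where Y1: "(tstep R ^^ k1) Z1 Y1" "tstep R Y1 (P1 @ x # Q1)"
      using less.prems by (auto elim: relpowp_Suc_E)
    from Y1(2) show ?thesis
    proof (cases rule: tstep_around_letter)
      case (left P')
      then show ?thesis using less.hyps[of k1 n2 P' x Q1 P2 Q2] less.prems Y1 Suc
        by (metis add_Suc lessI rtranclp.rtrancl_into_rtrancl)
    next
      case (right Q')
      then show ?thesis using less.hyps[of k1 n2 P1 x Q' P2 Q2] less.prems Y1 Suc by auto
    next
      case b1: (born \<rho> i j A1 L1 B1)
      show ?thesis
      proof (cases n2)
        case 0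
        then have "Z2 = P2 @ x # Q2" using less.prems by simp
        then show ?thesis using assms(4) b1 by auto
      next
        case (Suc k2)
        then obtain Y2 where Y2: "(tstep R ^^ k2) Z2 Y2" "tstep R Y2 (P2 @ x # Q2)"
          using less.prems by (auto elim: relpowp_Suc_E)
        from Y2(2) show ?thesis
        proof (cases rule: tstep_around_letter)
          case (left P')
          then show ?thesis using less.hyps[of n1 k2 P1 x Q1 P' Q2] less.prems Y2 Suc by auto
        next
          case (right Q')
          then show ?thesis using less.hyps[of n1 k2 P1 x Q1 P2 Q'] less.prems Y2 Suc
            by (metis add_Suc_right lessI rtranclp.rtrancl_into_rtrancl)
        next
          case b2: (born \<rho>' i' j' A2 L2 B2)
          have same: "\<rho>' = \<rho>" "i' = i" "j' = j" "orig (L2 ! i) = orig (L1 ! i)" "hist (L2 ! i) = hist (L1 ! i)"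
            using b1(9) b2(9) by auto
          have i2: "i < length L2" using b2(6) same by simp
          have "letter (L1 ! i) = lhs \<rho> ! i"
            using b1(5,6) by (metis nth_map)
          moreover have "letter (L2 ! i) = lhs \<rho> ! i"
            using b2(5,6) same by (metis nth_map)
          ultimately have p: "L2 ! i = L1 ! i"
            using same by (metis tletter.expand)
          define p where "p = L1 ! i"
          have L1: "L1 = take i L1 @ p # drop (Suc i) L1"
            using b1(6) by (simp add: p_def id_take_nth_drop)
          have L2: "L2 = take i L2 @ p # drop (Suc i) L2"
            using i2 p by (metis p_def id_take_nth_drop)
          have 1: "(tstep R ^^ k1) Z1 ((A1 @ take i L1) @ p # (drop (Suc i) L1 @ B1))"
            using Y1(1) b1(1) L1 by (metis append.assoc append_Cons)
          have 2: "(tstep R ^^ k2) Z2 ((A2 @ take i L2) @ p # (drop (Suc i) L2 @ B2))"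
            using Y2(1) b2(1) L2 by (metis append.assoc append_Cons)
          obtain l1 a r1 l2 r2 where S: "Z1 = l1 @ a # r1" "Z2 = l2 @ a # r2" "orig a = orig p"
            "(tstep R)\<^sup>*\<^sup>* (l1 @ a # r2) ((A1 @ take i L1) @ p # (drop (Suc i) L2 @ B2))"
            using less.hyps[OF _ 1 2] Suc \<open>n1 = Suc k1\<close> by auto
          \<comment> \<open>The left hand side in the spliced word: its part up to the parent comes from the first
  derivation, the rest from the second.\<close>
          define L where "L = take i L1 @ p # drop (Suc i) L2"
          have Li: "L ! i = p" "i < length L" using b1(6) by (auto simp: L_def nth_append)
          have "map letter L = take i (lhs \<rho>) @ letter p # drop (Suc i) (lhs \<rho>)"
            using b1(5) b2(5) same by (simp add: L_def take_map drop_map flip: b1(5))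
              (metis drop_map)
          also have "\<dots> = lhs \<rho>"
            using b1(5,6) \<open>letter (L1 ! i) = lhs \<rho> ! i\<close> p_def
            by (metis id_take_nth_drop length_map)
          finally have sL: "map letter L = lhs \<rho>" .
          have "\<forall>y \<in> set L. length (hist (L ! i)) \<le> length (hist y)"
            using b1(7) b2(7) same Li p_def unfolding L_def
            by (auto dest: in_set_takeD in_set_dropD)
          then have "tstep R (A1 @ L @ B2) (A1 @ offspring \<rho> i (L ! i) @ B2)"
            using b1 b2 same sL Li by (intro tstepI) auto
          also have "A1 @ offspring \<rho> i (L ! i) @ B2 = P1 @ x # Q2"
          proof -
            have jl: "j < length (offspring \<rho> i p)" using b1(8) by simp
            have "x = offspring \<rho> i p ! j" using b1(8,9) p_def by simp
            then have "offspring \<rho> i p = take j (offspring \<rho> i p) @ x # drop (Suc j) (offspring \<rho> i p)"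
              using jl id_take_nth_drop by blast
            then have "A1 @ offspring \<rho> i p @ B2 = A1 @ (take j (offspring \<rho> i p) @ x # drop (Suc j) (offspring \<rho> i p)) @ B2"
              by metis
            then show ?thesis using b1(10) b2(11) same p p_def Li by simp
          qed
          finally have st: "tstep R (A1 @ L @ B2) (P1 @ x # Q2)" .
          have "(tstep R)\<^sup>*\<^sup>* (l1 @ a # r2) (A1 @ L @ B2)"
            using S(4) by (simp add: L_def)
          then have "(tstep R)\<^sup>*\<^sup>* (l1 @ a # r2) (P1 @ x # Q2)"
            using st by (rule rtranclp.rtrancl_into_rtrancl)
          moreover have "orig a = orig x" using S(3) b1(9) p_def by simp
          ultimately show ?thesis using S by blast
        qed
      qed
    qed
  qed
qed

text \<open>Splicing requires the two letters to be equal including their origins. To splice at letters of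
different origins, the origins are first replaced by marks that only single out the letters in
question.\<close>

definition relabel :: "(nat \<Rightarrow> nat) \<Rightarrow> 'b tletter \<Rightarrow> 'b tletter" where
  "relabel f x = Traced (f (orig x)) (letter x) (hist x)"

lemma relabel_sel [simp]:
  "orig (relabel f x) = f (orig x)" "letter (relabel f x) = letter x" "hist (relabel f x) = hist x"
  by (simp_all add: relabel_def)

lemma map_letter_relabel [simp]: "map letter (map (relabel f) Z) = map letter Z"
  by simp

lemma tstep_relabel: "tstep R Z Z' \<Longrightarrow> tstep R (map (relabel f) Z) (map (relabel f) Z')"
proof (induction rule: tstep.induct)
  case (tstepI \<rho> P Q L i)
  have "map (relabel f) (offspring \<rho> i (L ! i)) = offspring \<rho> i (map (relabel f) L ! i)"
    using tstepI by (auto simp: offspring_def relabel_def)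
  then show ?case
    using tstep.tstepI[of \<rho> R "map (relabel f) P" "map (relabel f) Q" "map (relabel f) L" i] tstepI
    by (auto simp: comp_def)
qed

lemma tsteps_relabel:
  "(tstep R)\<^sup>*\<^sup>* Z Z' \<Longrightarrow> (tstep R)\<^sup>*\<^sup>* (map (relabel f) Z) (map (relabel f) Z')"
  by (induction rule: rtranclp_induct) (auto dest: tstep_relabel intro: rtranclp.rtrancl_into_rtrancl)

lemma splice_derivations:
  assumes "(tstep R)\<^sup>*\<^sup>* Z1 (P1 @ x # Q1)" "(tstep R)\<^sup>*\<^sup>* Z2 (P2 @ x # Q2)"
    and "\<forall>y \<in> set Z1. hist y = []" "\<forall>y \<in> set Z2. hist y = []"
  obtains l1 a r1 l2 r2 where "Z1 = l1 @ a # r1" "Z2 = l2 @ a # r2" "orig a = orig x"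
    "(tstep R)\<^sup>*\<^sup>* (l1 @ a # r2) (P1 @ x # Q2)"
  using splice_at_letter[OF _ _ assms(3,4)] assms(1,2) by (metis rtranclp_power)

lemma splice_once:
  fixes w1 w2 :: "'b list"
  assumes D1: "(tstep R)\<^sup>*\<^sup>* (start w1) (P1 @ x1 # Q1)"
    and D2: "(tstep R)\<^sup>*\<^sup>* (start w2) (P2 @ x2 # Q2)"
    and same: "letter x1 = letter x2" "hist x1 = hist x2"
  shows "(nca_step R)\<^sup>*\<^sup>* (take (orig x1) w1 @ drop (orig x2) w2) (map letter (P1 @ x1 # Q2))"
proof -
  define f where "f = (\<lambda>q (k::nat). if k = q then 1 else 0 :: nat)"
  define rl where "rl = (\<lambda>q. map (relabel (f q)) :: 'b tletter list \<Rightarrow> _)"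
  let ?x = "Traced 1 (letter x1) (hist x1)"
  have x: "relabel (f (orig x1)) x1 = ?x" "relabel (f (orig x2)) x2 = ?x"
    using same by (auto simp: relabel_def f_def)
  have "(tstep R)\<^sup>*\<^sup>* (rl (orig x1) (start w1)) (rl (orig x1) P1 @ ?x # rl (orig x1) Q1)"
    using tsteps_relabel[OF D1, of "f (orig x1)"] x by (simp add: rl_def)
  moreover have "(tstep R)\<^sup>*\<^sup>* (rl (orig x2) (start w2)) (rl (orig x2) P2 @ ?x # rl (orig x2) Q2)"
    using tsteps_relabel[OF D2, of "f (orig x2)"] x by (simp add: rl_def)
  ultimately obtain l1 a r1 l2 r2 where S: "rl (orig x1) (start w1) = l1 @ a # r1"
      "rl (orig x2) (start w2) = l2 @ a # r2" "orig a = 1"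
      "(tstep R)\<^sup>*\<^sup>* (l1 @ a # r2) (rl (orig x1) P1 @ ?x # rl (orig x2) Q2)"
    by (rule splice_derivations) (auto simp: rl_def hist_start)
  have pos: "length l = q" if "rl q (start w) = l @ a # r" for q w l r
  proof -
    have "length l < length (rl q (start w))" using that by simp
    then have l: "length l < length w" by (simp add: rl_def)
    have "a = rl q (start w) ! length l" using that by simp
    also have "\<dots> = relabel (f q) (Traced (length l) (w ! length l) [])"
      using l by (simp add: rl_def)
    finally show ?thesis using S(3) by (auto simp: f_def split: if_splits)
  qed
  have l1: "l1 = take (orig x1) (rl (orig x1) (start w1))"
    using pos[OF S(1)] S(1) by simp
  have r2: "a # r2 = drop (orig x2) (rl (orig x2) (start w2))"
    using pos[OF S(2)] S(2) by simp
  have "map letter (l1 @ a # r2) = take (orig x1) w1 @ drop (orig x2) w2"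
    unfolding map_append l1 r2 by (simp add: rl_def flip: take_map drop_map del: map_map)
  then show ?thesis
    using tsteps_imp_nca_steps[OF S(4)] by (simp add: rl_def comp_def)
qed

text \<open>The first splice takes the end from the second derivation. Its result still contains the letter
\<open>y\<close> with its history, so it can be spliced again at \<open>y\<close>, now taking the end from the first
derivation. The effect is to exchange only the middle part.\<close>

lemma splice_twice:
  fixes w1 w2 :: "'b list"
  assumes D1: "(tstep R)\<^sup>*\<^sup>* (start w1) (P1 @ x1 # M1 @ y1 # Q1)"
    and D2: "(tstep R)\<^sup>*\<^sup>* (start w2) (P2 @ x2 # M2 @ y2 # Q2)"
    and same: "letter x1 = letter x2" "hist x1 = hist x2" "letter y1 = letter y2" "hist y1 = hist y2"
    and ord: "orig x1 < orig y1" "orig x2 < orig y2"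
  shows "(nca_step R)\<^sup>*\<^sup>*
    (take (orig x1) w1 @ drop (orig x2) (take (orig y2) w2) @ drop (orig y1) w1)
    (map letter (P1 @ x1 # M2 @ y1 # Q1))"
proof -
  \<comment> \<open>The marks 1 and 2 identify the two letters at which to splice.\<close>
  define f where "f = (\<lambda>q q' (k::nat). if k = q then 1 else if k = q' then 2 else 0 :: nat)"
  let ?f1 = "f (orig x1) (orig y1)" and ?f2 = "f (orig x2) (orig y2)"
  define rl1 where "rl1 = (map (relabel ?f1) :: 'b tletter list \<Rightarrow> _)"
  define rl2 where "rl2 = (map (relabel ?f2) :: 'b tletter list \<Rightarrow> _)"
  let ?x = "Traced 1 (letter x1) (hist x1)" and ?y = "Traced 2 (letter y1) (hist y1)"
  have xy: "relabel ?f1 x1 = ?x" "relabel ?f2 x2 = ?x" "relabel ?f1 y1 = ?y" "relabel ?f2 y2 = ?y"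
    using same ord by (auto simp: relabel_def f_def)
  have E1: "(tstep R)\<^sup>*\<^sup>* (rl1 (start w1)) (rl1 P1 @ ?x # rl1 M1 @ ?y # rl1 Q1)"
    using tsteps_relabel[OF D1, of ?f1] xy by (simp add: rl1_def)
  have E2: "(tstep R)\<^sup>*\<^sup>* (rl2 (start w2)) (rl2 P2 @ ?x # rl2 M2 @ ?y # rl2 Q2)"
    using tsteps_relabel[OF D2, of ?f2] xy by (simp add: rl2_def)
  have h: "\<forall>y \<in> set (rl1 (start w1)). hist y = []" "\<forall>y \<in> set (rl2 (start w2)). hist y = []"
    by (auto simp: rl1_def rl2_def hist_start)
  obtain l1 a r1 l2 r2 where S: "rl1 (start w1) = l1 @ a # r1"
      "rl2 (start w2) = l2 @ a # r2" "orig a = 1"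
      "(tstep R)\<^sup>*\<^sup>* (l1 @ a # r2) (rl1 P1 @ ?x # rl2 M2 @ ?y # rl2 Q2)"
    by (rule splice_derivations[OF E1 E2 h, unfolded tletter.sel])
  have G1: "\<forall>y \<in> set (l1 @ a # r2). hist y = []"
    using h S(1,2) by auto
  have G2: "(tstep R)\<^sup>*\<^sup>* (l1 @ a # r2) ((rl1 P1 @ ?x # rl2 M2) @ ?y # rl2 Q2)"
    using S(4) by simp
  have G3: "(tstep R)\<^sup>*\<^sup>* (rl1 (start w1)) ((rl1 P1 @ ?x # rl1 M1) @ ?y # rl1 Q1)"
    using E1 by simp
  obtain l b r l' r' where T: "l1 @ a # r2 = l @ b # r"
      "rl1 (start w1) = l' @ b # r'" "orig b = 2"
      "(tstep R)\<^sup>*\<^sup>* (l @ b # r') ((rl1 P1 @ ?x # rl2 M2) @ ?y # rl1 Q1)"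
    by (rule splice_derivations[OF G2 G3 G1 h(1), unfolded tletter.sel])
  have at1: "orig c = ?f1 (length l)" "length l < length w1" if "rl1 (start w1) = l @ c # r" for l c r
  proof -
    have "length l < length (rl1 (start w1))" using that by simp
    then show l: "length l < length w1" by (simp add: rl1_def)
    have "c = rl1 (start w1) ! length l" using that by simp
    then show "orig c = ?f1 (length l)" using l by (simp add: rl1_def)
  qed
  have at2: "orig c = ?f2 (length l)" "length l < length w2" if "rl2 (start w2) = l @ c # r" for l c r
  proof -
    have "length l < length (rl2 (start w2))" using that by simp
    then show l: "length l < length w2" by (simp add: rl2_def)
    have "c = rl2 (start w2) ! length l" using that by simp
    then show "orig c = ?f2 (length l)" using l by (simp add: rl2_def)
  qed
  have pl1: "length l1 = orig x1"
    using at1(1)[OF S(1)] unfolding S(3) f_def by presburger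
  have pl2: "length l2 = orig x2"
    using at2(1)[OF S(2)] unfolding S(3) f_def by presburger
  have pl': "length l' = orig y1"
    using at1(1)[OF T(2)] unfolding T(3) f_def by presburger
  have "\<not> length l < length l1"
  proof
    assume less: "length l < length l1"
    have "l1 ! length l = (l @ b # r) ! length l"
      using less by (metis T(1) nth_append)
    then have "l1 ! length l = b" by simp
    then have "rl1 (start w1) ! length l = b" using less S(1) by (simp add: nth_append)
    moreover have "length l < length w1" using less at1(2)[OF S(1)] by simp
    ultimately have "orig b = ?f1 (length l)" by (auto simp: rl1_def)
    then show False using less pl1 ord unfolding T(3) f_def by presburger
  qed
  then have "take (length l1) (l @ b # r) = take (length l1) l" by simp
  then have "l1 = take (length l1) l" unfolding T(1)[symmetric] by simp
  then obtain d where d: "l = l1 @ d" by (metis append_take_drop_id)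
  then have "a # r2 = d @ b # r" using T(1) by simp
  have "rl2 (start w2) = (l2 @ d) @ b # r" using S(2) \<open>a # r2 = d @ b # r\<close> by simp
  from at2(1)[OF this] have pd: "length (l2 @ d) = orig y2"
    unfolding T(3) f_def by presburger
  have "l1 = take (orig x1) (rl1 (start w1))" using S(1) pl1 by simp
  then have 1: "map letter l1 = take (orig x1) w1" by (simp add: rl1_def flip: take_map drop_map del: map_map)
  have "d = drop (orig x2) (take (orig y2) (rl2 (start w2)))"
    using \<open>rl2 (start w2) = (l2 @ d) @ b # r\<close> pd pl2 by simp
  then have 2: "map letter d = drop (orig x2) (take (orig y2) w2)"
    by (simp add: rl2_def flip: take_map drop_map del: map_map)
  have "b # r' = drop (orig y1) (rl1 (start w1))" using T(2) pl' by simp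
  then have 3: "map letter (b # r') = drop (orig y1) w1"
    by (simp add: rl1_def flip: take_map drop_map del: map_map list.map)
  have "map letter (l @ b # r') = take (orig x1) w1 @ drop (orig x2) (take (orig y2) w2) @ drop (orig y1) w1"
    unfolding d map_append 1 2 3 by simp
  then show ?thesis
    using tsteps_imp_nca_steps[OF T(4)] by (simp add: rl1_def rl2_def comp_def)
qed

section \<open>Long histories are rare\<close>

definition older :: "nat \<Rightarrow> 'b tletter list \<Rightarrow> nat" where
  "older k E = length (filter (\<lambda>x. k \<le> length (hist x)) E)"

lemma older_append [simp]: "older k (E @ F) = older k E + older k F"
  by (simp add: older_def)

lemma older_start: "older k (start w) = (if k = 0 then length w else 0)"
  by (simp add: older_def start_def comp_def)

lemma older_offspring:
  "older k (offspring \<rho> i x) = (if k \<le> Suc (length (hist x)) then length (rhs \<rho>) else 0)"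
  by (simp add: older_def offspring_def comp_def)

context nca
begin

text \<open>The list \<open>E\<close> collects every letter that is ever created. A step creates letters with histories
longer than \<open>k\<close> only by consuming a left hand side all of whose letters have histories of length
at least \<open>k\<close>, and the right hand side is shorter by at least one letter out of at most \<open>Suc V\<close>.
The second summand on the left accounts for the letters with such histories that can still be
consumed; it makes the inequality an invariant.\<close>

lemma generation_counts:
  fixes V :: nat
  assumes short: "\<And>\<rho>. \<rho> \<in> R \<Longrightarrow> length (lhs \<rho>) \<le> Suc V"
    and "Z 0 = start w" "\<And>t. t < m \<Longrightarrow> tstep R (Z t) (Z (Suc t))"
  shows "\<exists>E. (\<forall>t\<le>m. set (Z t) \<subseteq> set E) \<and> older 0 E = length w + older 1 E \<and>
           (\<forall>k. Suc V * older (Suc k) E + V * older k (Z m) \<le> V * older k E)"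
  using assms(3)
proof (induction m)
  case 0
  then show ?case
    using assms(2) by (intro exI[of _ "start w"]) (auto simp: older_start)
next
  case (Suc m)
  then obtain E where E: "\<forall>t\<le>m. set (Z t) \<subseteq> set E" "older 0 E = length w + older 1 E"
    "\<And>k. Suc V * older (Suc k) E + V * older k (Z m) \<le> V * older k E"
    by (metis less_Suc_eq)
  have "tstep R (Z m) (Z (Suc m))" using Suc.prems by simp
  then show ?case
  proof cases
    case (tstepI \<rho> P Q L i)
    define b where "b = offspring \<rho> i (L ! i)"
    have "length L = length (lhs \<rho>)" using tstepI(6) by (metis length_map)
    then have len: "length L \<le> Suc V" "length (rhs \<rho>) < length L"
      using short length_reducing tstepI(3) by auto
    have step: "Suc V * older (Suc k) b + V * older k b \<le> V * older k b + V * older k L" for k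
    proof (cases "k \<le> length (hist (L ! i))")
      case True
      then have "\<forall>y \<in> set L. k \<le> length (hist y)" using tstepI(8) by auto
      then have "older k L = length L" by (simp add: older_def)
      moreover have "older (Suc k) b = length (rhs \<rho>)"
        using True by (simp add: b_def older_offspring)
      moreover have "Suc V * length (rhs \<rho>) \<le> V * length L"
      proof -
        obtain l where l: "length L = Suc l" using len by (cases "length L") auto
        have "Suc V * length (rhs \<rho>) \<le> Suc V * l" using len l by (intro mult_le_mono2) simp
        also have "\<dots> \<le> V * Suc l" using len l by simp
        finally show ?thesis using l by simp
      qed
      ultimately show ?thesis by simp
    next
      case False
      then show ?thesis by (simp add: b_def older_offspring)
    qed
    have "Suc V * older (Suc k) (E @ b) + V * older k (Z (Suc m)) \<le> V * older k (E @ b)" for k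
      using E(3)[of k] step[of k] unfolding tstepI b_def[symmetric] by (simp add: algebra_simps)
    moreover have "older 0 (E @ b) = length w + older 1 (E @ b)"
      using E(2) by (simp add: b_def older_offspring)
    moreover have "\<forall>t\<le>Suc m. set (Z t) \<subseteq> set (E @ b)"
    proof (intro allI impI)
      fix t assume t: "t \<le> Suc m"
      have "set (Z m) \<subseteq> set E" using E(1) by blast
      then have "set (Z (Suc m)) \<subseteq> set (E @ b)"
        unfolding tstepI(1,2) b_def[symmetric] by auto
      moreover have "set (Z t) \<subseteq> set E" if "t \<noteq> Suc m"
        using E(1) t that by (metis le_SucE)
      ultimately show "set (Z t) \<subseteq> set (E @ b)" by (cases "t = Suc m") auto
    qed
    ultimately show ?thesis by blast
  qed
qed

lemma few_old_letters:
  fixes V :: nat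
  assumes "\<And>\<rho>. \<rho> \<in> R \<Longrightarrow> length (lhs \<rho>) \<le> Suc V"
    and "Z 0 = start w" "\<And>t. t < m \<Longrightarrow> tstep R (Z t) (Z (Suc t))"
  shows "finite {x. \<exists>t\<le>m. x \<in> set (Z t) \<and> k \<le> length (hist x)}" (is "finite ?S")
    and "real (card {x. \<exists>t\<le>m. x \<in> set (Z t) \<and> k \<le> length (hist x)})
           \<le> (V / Suc V) ^ k * (Suc V * length w)"
proof -
  obtain E where E: "\<forall>t\<le>m. set (Z t) \<subseteq> set E" "older 0 E = length w + older 1 E"
    "\<And>k. Suc V * older (Suc k) E + V * older k (Z m) \<le> V * older k E"
    using generation_counts[OF assms] by blast
  have sub: "?S \<subseteq> set (filter (\<lambda>x. k \<le> length (hist x)) E)"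
    using E(1) by auto
  then show "finite ?S" by (rule finite_subset) simp
  have "card ?S \<le> older k E"
    unfolding older_def by (rule order_trans[OF card_mono[OF List.finite_set sub] card_length])
  also have "real (older k E) \<le> (V / Suc V) ^ k * (Suc V * length w)"
  proof (induction k)
    case 0
    have "Suc V * older 1 E \<le> V * older 0 E" using E(3)[of 0] by simp
    also have "\<dots> = V * length w + V * older 1 E" using E(2) by (simp add: algebra_simps)
    finally have "older 1 E \<le> V * length w" by simp
    then have "older 0 E \<le> Suc V * length w" using E(2) by simp
    then show ?case by (metis mult_1 of_nat_le_iff power_0)
  next
    case (Suc k)
    have "Suc V * older (Suc k) E \<le> V * older k E" using E(3)[of k] by simp
    then have "real (Suc V) * real (older (Suc k) E) \<le> real V * real (older k E)"
      by (metis of_nat_le_iff of_nat_mult)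
    then have "real (older (Suc k) E) \<le> V / Suc V * older k E"
      by (simp add: field_simps)
    also have "\<dots> \<le> V / Suc V * ((V / Suc V) ^ k * (Suc V * length w))"
      using Suc by (intro mult_left_mono) auto
    finally show ?case by (simp add: mult.assoc)
  qed
  finally show "real (card ?S) \<le> (V / Suc V) ^ k * (Suc V * length w)" by simp
qed

lemma traced_run:
  assumes "(nca_step R)\<^sup>*\<^sup>* w []"
  obtains Z :: "nat \<Rightarrow> 'b tletter list" and m where "Z 0 = start w" "Z m = []"
    "\<And>t. t < m \<Longrightarrow> tstep R (Z t) (Z (Suc t))"
proof -
  obtain Y where "(tstep R)\<^sup>*\<^sup>* (start w) Y" "map letter Y = []"
    using trace_derivation[OF assms] by blast
  then obtain m where "(tstep R ^^ m) (start w) []"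
    by (auto simp: rtranclp_power)
  then show thesis
    using that unfolding relpowp_fun_conv by blast
qed

lemma tstep_sorted:
  assumes "tstep R Z Z'" "sorted (map orig Z)"
  shows "sorted (map orig Z')"
  using assms(1)
proof cases
  case (tstepI \<rho> P Q L i)
  have replace: "sorted (p @ b @ q)"
    if "sorted (p @ l @ q)" "sorted b" "set b \<subseteq> set l" for p b q l :: "nat list"
    using that unfolding sorted_append set_append by blast
  let ?O = "offspring \<rho> i (L ! i)"
  have eq: "map orig ?O = replicate (length (rhs \<rho>)) (orig (L ! i))"
    by (simp add: offspring_def comp_def map_replicate_const)
  have "L ! i \<in> set L" using tstepI(7) by (rule nth_mem)
  then have "set (map orig ?O) \<subseteq> set (map orig L)"
    unfolding eq by (auto simp: set_replicate_conv_if)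
  moreover have "sorted (map orig ?O)"
    unfolding eq by (simp add: sorted_replicate)
  moreover have "sorted (map orig P @ map orig L @ map orig Q)"
    using assms(2) unfolding tstepI(1) by simp
  ultimately have "sorted (map orig P @ map orig ?O @ map orig Q)"
    by (metis replace)
  then show ?thesis unfolding tstepI(2) by simp
qed

lemma sorted_start: "sorted (map orig (start w))"
  by (simp add: start_def comp_def)

definition trace_marks :: "nat \<Rightarrow> ('b rule \<times> nat \<times> nat) set" where
  "trace_marks W = R \<times> {..<W} \<times> {..<W}"

lemma finite_trace_marks: "finite (trace_marks W)"
  by (simp add: trace_marks_def finite_rules)

lemma tstep_letters:
  assumes "\<And>\<rho>. \<rho> \<in> R \<Longrightarrow> length (lhs \<rho>) \<le> W"
  shows "tstep R Z Z' \<Longrightarrow> \<forall>x\<in>set Z. letter x \<in> A \<and> set (hist x) \<subseteq> trace_marks W \<Longrightarrow>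
    \<forall>x\<in>set Z'. letter x \<in> A \<and> set (hist x) \<subseteq> trace_marks W"
proof (induction rule: tstep.induct)
  case (tstepI \<rho> P Q L i)
  have L: "L ! i \<in> set L" "length L = length (lhs \<rho>)"
    using tstepI by (auto simp flip: length_map[of letter L])
  have "length (rhs \<rho>) < W" "i < W"
    using assms[OF tstepI(1)] length_reducing[OF tstepI(1)] tstepI(5) L by auto
  moreover have "rhs \<rho> ! j \<in> A" if "j < length (rhs \<rho>)" for j
    using rule_words[OF tstepI(1)] that by (auto simp: in_lists_conv_set)
  moreover have "set (hist (L ! i)) \<subseteq> trace_marks W"
    using tstepI(7) L by auto
  ultimately have "\<forall>x\<in>set (offspring \<rho> i (L ! i)). letter x \<in> A \<and> set (hist x) \<subseteq> trace_marks W"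
    using tstepI(1) by (auto simp: offspring_def trace_marks_def)
  then show ?case using tstepI(7) by (simp add: ball_Un)
qed

end

section \<open>The letters on either side of an origin\<close>

definition below :: "nat \<Rightarrow> 'b tletter list \<Rightarrow> 'b tletter list" where
  "below c Z = filter (\<lambda>z. orig z < c) Z"

definition above :: "nat \<Rightarrow> 'b tletter list \<Rightarrow> 'b tletter list" where
  "above c Z = filter (\<lambda>z. c \<le> orig z) Z"

lemma below_append [simp]: "below c (Y @ Z) = below c Y @ below c Z"
  by (simp add: below_def)

lemma below_above:
  assumes "sorted (map orig Z)"
  shows "Z = below c Z @ above c Z"
  using assms
proof (induction Z)
  case (Cons z Z)
  show ?case
  proof (cases "orig z < c")
    case True
    then show ?thesis using Cons by (simp add: below_def above_def)
  next
    case False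
    then have "\<forall>y\<in>set (z # Z). c \<le> orig y" using Cons.prems by auto
    then have "below c (z # Z) = []" "above c (z # Z) = z # Z"
      by (auto simp: below_def above_def filter_empty_conv intro!: filter_True)
    then show ?thesis by simp
  qed
qed (simp add: below_def above_def)

lemma orig_hd_above_le:
  assumes "sorted (map orig Z)" "z \<in> set Z" "c \<le> orig z"
  shows "above c Z \<noteq> []" "c \<le> orig (hd (above c Z))" "orig (hd (above c Z)) \<le> orig z"
proof -
  have z: "z \<in> set (above c Z)" using assms by (simp add: above_def)
  then show ne: "above c Z \<noteq> []" by auto
  then have "hd (above c Z) \<in> set (above c Z)" by simp
  then show "c \<le> orig (hd (above c Z))" unfolding above_def by simp
  have "sorted (map orig (above c Z))"
    using assms(1) below_above[of Z c] by (metis map_append sorted_append)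
  moreover obtain a b where "above c Z = a # b" using ne by (cases "above c Z") auto
  ultimately show "orig (hd (above c Z)) \<le> orig z"
    using z by auto
qed

text \<open>A step can only shift the boundary of the letters below a given origin within its own left hand
side, apart from one letter to the left of it when nothing from below survives there.\<close>

lemma (in nca) last_below_step:
  assumes "tstep R Z Z'" "sorted (map orig Z)" "below c Z \<noteq> []" "below c Z' \<noteq> []"
    and short: "\<And>\<rho>. \<rho> \<in> R \<Longrightarrow> length (lhs \<rho>) \<le> W"
  shows "orig (last (below c Z')) = orig (last (below c Z)) \<or>
    (\<exists>P z M Q. Z = P @ z # M @ last (below c Z) # Q \<and> orig z = orig (last (below c Z')) \<and> length M \<le> W)"
  using assms(1)
proof cases
  case (tstepI \<rho> P Q L i)
  define b where "b = offspring \<rho> i (L ! i)"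
  have L: "L ! i \<in> set L" "length L \<le> W"
    using tstepI(6,7) short[OF tstepI(3)] by (auto simp flip: length_map[of letter L])
  have b: "orig y = orig (L ! i)" if "y \<in> set b" for y
    using that orig_offspring unfolding b_def by blast
  have Z: "below c Z = below c P @ below c L @ below c Q"
    "below c Z' = below c P @ below c b @ below c Q"
    by (simp_all add: tstepI(1,2) b_def)
  show ?thesis
  proof (cases "below c Q = []")
    case False
    then show ?thesis by (simp add: Z)
  next
    case Q: True
    show ?thesis
    proof (cases "below c L = []")
      case True
      have "below c b = []"
      proof -
        have "\<not> orig (L ! i) < c" using True L(1) by (auto simp: below_def filter_empty_conv)
        then show ?thesis using b by (auto simp: below_def filter_empty_conv)
      qed
      then show ?thesis using True Q by (simp add: Z)
    next
      case False
      define x where "x = last (below c L)"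
      have "x \<in> set (below c L)" unfolding x_def using False by (rule last_in_set)
      then have "x \<in> set L" "orig x < c" by (simp_all add: below_def)
      moreover have "last (below c Z) = x" using False Q by (simp add: Z x_def)
      ultimately have x: "last (below c Z) = x" "x \<in> set L" "orig x < c" by blast+
      have "\<forall>p\<in>set P. orig p < c"
      proof
        fix p assume "p \<in> set P"
        moreover have "\<forall>a\<in>set (map orig P). \<forall>b\<in>set (map orig L @ map orig Q). a \<le> b"
          using assms(2) unfolding tstepI(1) map_append sorted_append by (elim conjE)
        ultimately have "orig p \<le> orig x" using x(2) by simp
        then show "orig p < c" using x(3) by simp
      qed
      then have P: "below c P = P" by (simp add: below_def)
      have sL: "sorted (map orig L)" using assms(2) unfolding tstepI(1) by (simp add: sorted_append)
      have "below c L = butlast (below c L) @ [x]" using False by (simp add: x_def)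
      then have Lx: "L = butlast (below c L) @ x # above c L"
        using below_above[OF sL, of c] by (metis append.assoc append_Cons append_Nil)
      show ?thesis
      proof (cases "below c b = []")
        case True
        then have "P \<noteq> []" using assms(4) Q P by (simp add: Z)
        then have "Z = butlast P @ last P # butlast (below c L) @ x # above c L @ Q"
          using Lx unfolding tstepI(1) by (metis append.assoc append_Cons append_Nil append_butlast_last_id)
        moreover have "last (below c Z') = last P" using True Q P by (simp add: Z)
        moreover have "length (butlast (below c L)) \<le> W"
          using L(2) arg_cong[OF Lx, of length] by simp
        ultimately show ?thesis using x(1) by metis
      next
        case nb: False
        then have "last (below c Z') \<in> set (below c b)" using Q by (simp add: Z)
        then have o: "orig (last (below c Z')) = orig (L ! i)" "orig (L ! i) < c"
          using b by (auto simp: below_def)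
        then have "L ! i \<in> set (below c L)" using L(1) by (simp add: below_def)
        then obtain p q where pq: "below c L = p @ L ! i # q" by (meson split_list)
        show ?thesis
        proof (cases "q = []")
          case True
          then have "x = L ! i" using pq by (simp add: x_def)
          then show ?thesis using o x(1) by simp
        next
          case False
          then have "q = butlast q @ [x]" using pq by (simp add: x_def)
          then have "L = p @ L ! i # butlast q @ x # above c L"
            using below_above[OF sL, of c] pq by (metis append.assoc append_Cons append_Nil)
          then have eq: "L = (p @ [L ! i]) @ (butlast q @ x # above c L)" by simp
          have "length (butlast q) \<le> W" using L(2) arg_cong[OF eq, of length] by simp
          moreover have "Z = (P @ p) @ L ! i # butlast q @ x # (above c L @ Q)"
            unfolding tstepI(1) using eq by (metis append.assoc append_Cons append_Nil)
          ultimately show ?thesis using o x(1) by metis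
        qed
      qed
    qed
  qed
qed

lemma above_split:
  assumes "c \<le> (d :: nat)"
  shows "sorted (map orig Y) \<Longrightarrow> above c Y = filter (\<lambda>z. c \<le> orig z \<and> orig z < d) Y @ above d Y"
proof -
  assume s: "sorted (map orig Y)"
  have "above c Y = above c (below d Y) @ above c (above d Y)"
    using below_above[OF s, of d] by (metis above_def filter_append)
  moreover have "above c (above d Y) = above d Y"
    using assms by (auto simp: above_def filter_filter intro!: filter_cong)
  moreover have "above c (below d Y) = filter (\<lambda>z. c \<le> orig z \<and> orig z < d) Y"
    by (auto simp: above_def below_def intro!: filter_cong)
  ultimately show ?thesis by simp
qed

lemma below_split:
  assumes "c \<le> (d :: nat)"
  shows "sorted (map orig Y) \<Longrightarrow> below d Y = below c Y @ filter (\<lambda>z. c \<le> orig z \<and> orig z < d) Y"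
proof -
  assume s: "sorted (map orig Y)"
  have "below d Y = below d (below c Y) @ below d (above c Y)"
    using below_above[OF s, of c] by (metis below_def filter_append)
  moreover have "below d (below c Y) = below c Y"
    using assms by (auto simp: below_def filter_filter intro!: filter_cong)
  moreover have "below d (above c Y) = filter (\<lambda>z. c \<le> orig z \<and> orig z < d) Y"
    by (auto simp: above_def below_def intro!: filter_cong)
  ultimately show ?thesis by simp
qed

section \<open>Group elements between traced letters\<close>

text \<open>The evaluation \<open>ev\<close> of input letters is kept abstract, so that the generators may be a tagged
copy of a subset of the group.\<close>

locale cannon_group = group G + nca X A R
  for G :: "('a, 'm) monoid_scheme" (structure) and X A :: "'b set" and R :: "'b rule set" +
  fixes ev :: "'b \<Rightarrow> 'a" and V :: nat
  assumes ev_closed: "x \<in> X \<Longrightarrow> ev x \<in> carrier G"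
    and solves_word_problem:
      "w \<in> lists X \<Longrightarrow> (nca_step R)\<^sup>*\<^sup>* w [] \<longleftrightarrow> word_value G (map ev w) = \<one>"
    and short_rules: "\<rho> \<in> R \<Longrightarrow> length (lhs \<rho>) \<le> Suc V"
begin

definition val :: "'b list \<Rightarrow> 'a" where
  "val w = word_value G (map ev w)"

lemma val_Nil [simp]: "val [] = \<one>"
  by (simp add: val_def word_value_def)

lemma val_Cons [simp]: "val (x # w) = ev x \<otimes> val w"
  by (simp add: val_def word_value_def)

lemma val_closed [simp, intro]: "w \<in> lists X \<Longrightarrow> val w \<in> carrier G"
  by (induction rule: lists.induct) (auto simp: ev_closed)

lemma val_append: "v \<in> lists X \<Longrightarrow> w \<in> lists X \<Longrightarrow> val (v @ w) = val v \<otimes> val w"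
  by (induction v rule: lists.induct) (auto simp: ev_closed m_assoc)

lemma lists_take: "w \<in> lists X \<Longrightarrow> take k w \<in> lists X"
  by (auto simp: in_lists_conv_set dest: in_set_takeD)

lemma lists_drop: "w \<in> lists X \<Longrightarrow> drop k w \<in> lists X"
  by (auto simp: in_lists_conv_set dest: in_set_dropD)

definition pre :: "'b list \<Rightarrow> nat \<Rightarrow> 'a" where
  "pre w k = val (take k w)"

lemma pre_closed [simp, intro]: "w \<in> lists X \<Longrightarrow> pre w k \<in> carrier G"
  by (simp add: pre_def lists_take)

lemma pre_drop: "w \<in> lists X \<Longrightarrow> pre w k \<otimes> val (drop k w) = val w"
  unfolding pre_def by (metis append_take_drop_id lists_drop lists_take val_append)

lemma pre_slice: "w \<in> lists X \<Longrightarrow> j \<le> k \<Longrightarrow> pre w k = pre w j \<otimes> val (drop j (take k w))"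
proof -
  assume w: "w \<in> lists X" and "j \<le> k"
  then have "take k w = take j w @ drop j (take k w)"
    using append_take_drop_id[of j "take k w"] by (simp add: min.absorb1 del: append_take_drop_id)
  then show ?thesis
    unfolding pre_def using w by (metis lists_drop lists_take val_append)
qed

text \<open>The last conjunct records that the reduction can still be completed. It is what forces
the spliced words to represent the identity.\<close>

definition state :: "'b list \<Rightarrow> 'b tletter list \<Rightarrow> bool" where
  "state w Z \<longleftrightarrow> w \<in> lists X \<and> (tstep R)\<^sup>*\<^sup>* (start w) Z \<and> (nca_step R)\<^sup>*\<^sup>* (map letter Z) []"

lemma state_value: "state w Z \<Longrightarrow> val w = \<one>"
  using tsteps_imp_nca_steps[of R "start w" Z] solves_word_problem[of w]
  by (auto simp: state_def val_def dest: rtranclp_trans)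

lemma state_letters:
  assumes "state w Z" "x \<in> set Z"
  shows "letter x \<in> A" "set (hist x) \<subseteq> trace_marks (Suc V)"
proof -
  have "(tstep R)\<^sup>*\<^sup>* (start w) Z" and w: "w \<in> lists X" using assms by (auto simp: state_def)
  then have "\<forall>x\<in>set Z. letter x \<in> A \<and> set (hist x) \<subseteq> trace_marks (Suc V)"
  proof (induction rule: rtranclp_induct)
    case base
    then show ?case using input_subset by (auto simp: start_def in_lists_conv_set)
  next
    case (step Y Z)
    then show ?case using tstep_letters[OF short_rules] by blast
  qed
  then show "letter x \<in> A" "set (hist x) \<subseteq> trace_marks (Suc V)" using assms by auto
qed

lemma state_sorted: "state w Z \<Longrightarrow> sorted (map orig Z)"
proof -
  assume "state w Z"
  then have "(tstep R)\<^sup>*\<^sup>* (start w) Z" by (simp add: state_def)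
  then show ?thesis
    by (induction rule: rtranclp_induct) (auto intro: sorted_start tstep_sorted)
qed

text \<open>Exchanging the part of \<open>w1\<close> between the two origins for that of \<open>w2\<close> yields a word that
reduces to the word \<open>P1 x1 M1 y1 Q1\<close> reached from \<open>w1\<close>, hence to the empty word. So the exchange
has not changed the value.\<close>

lemma slices_equal:
  assumes 1: "state w1 (P1 @ x1 # M1 @ y1 # Q1)" and 2: "state w2 (P2 @ x2 # M2 @ y2 # Q2)"
    and same: "letter x1 = letter x2" "hist x1 = hist x2" "letter y1 = letter y2" "hist y1 = hist y2"
      "map letter M1 = map letter M2"
    and ord: "orig x1 < orig y1" "orig x2 < orig y2"
  shows "val (drop (orig x1) (take (orig y1) w1)) = val (drop (orig x2) (take (orig y2) w2))"
    (is "?m1 = ?m2")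
proof -
  let ?l = "take (orig x1) w1" and ?r = "drop (orig y1) w1"
  let ?n1 = "drop (orig x1) (take (orig y1) w1)" and ?n2 = "drop (orig x2) (take (orig y2) w2)"
  have w: "w1 \<in> lists X" "w2 \<in> lists X" using 1 2 by (auto simp: state_def)
  note L = w[THEN lists_take] w[THEN lists_drop] w[THEN lists_take, THEN lists_drop]
  have "(nca_step R)\<^sup>*\<^sup>* (?l @ ?n2 @ ?r) (map letter (P1 @ x1 # M2 @ y1 # Q1))"
    using splice_twice[of R w1 P1 x1 M1 y1 Q1 w2 P2 x2 M2 y2 Q2] 1 2 same ord
    by (simp add: state_def)
  also have "map letter (P1 @ x1 # M2 @ y1 # Q1) = map letter (P1 @ x1 # M1 @ y1 # Q1)"
    using same by simp
  also have "(nca_step R)\<^sup>*\<^sup>* \<dots> []" using 1 by (simp add: state_def)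
  finally have "val (?l @ ?n2 @ ?r) = \<one>"
    using solves_word_problem[of "?l @ ?n2 @ ?r"] L by (simp add: val_def)
  then have eq2: "val ?l \<otimes> (val ?n2 \<otimes> val ?r) = \<one>"
    using L by (simp add: val_append del: append_take_drop_id)
  have "?l @ ?n1 @ ?r = w1"
    using append_take_drop_id[of "orig x1" "take (orig y1) w1"] append_take_drop_id[of "orig y1" w1] ord
    by (simp add: min.absorb1 del: append_take_drop_id flip: append.assoc)
  then have "val (?l @ ?n1 @ ?r) = \<one>" using state_value[OF 1] by simp
  then have "val ?l \<otimes> (val ?n1 \<otimes> val ?r) = \<one>"
    using L by (simp add: val_append del: append_take_drop_id)
  then have "val ?l \<otimes> (val ?n1 \<otimes> val ?r) = val ?l \<otimes> (val ?n2 \<otimes> val ?r)"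
    using eq2 by simp
  then show ?thesis using L by simp
qed

text \<open>The analogue of \<open>slices_equal\<close> in which the beginning of the word takes the place of the first
letter.\<close>

lemma left_end_equal:
  assumes 1: "state w1 (P1 @ x1 # Q1)" and 2: "state w2 (P2 @ x2 # Q2)"
    and same: "letter x1 = letter x2" "hist x1 = hist x2" "map letter P1 = map letter P2"
  shows "pre w1 (orig x1) = pre w2 (orig x2)"
proof -
  let ?l = "take (orig x2) w2" and ?r = "drop (orig x1) w1"
  have w: "w1 \<in> lists X" "w2 \<in> lists X" using 1 2 by (auto simp: state_def)
  note L = w[THEN lists_take] w[THEN lists_drop]
  have "(nca_step R)\<^sup>*\<^sup>* (?l @ ?r) (map letter (P2 @ x2 # Q1))"
    using splice_once[of R w2 P2 x2 Q2 w1 P1 x1 Q1] 1 2 same by (simp add: state_def)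
  also have "map letter (P2 @ x2 # Q1) = map letter (P1 @ x1 # Q1)"
    using same by simp
  also have "(nca_step R)\<^sup>*\<^sup>* \<dots> []" using 1 by (simp add: state_def)
  finally have "val (?l @ ?r) = \<one>"
    using solves_word_problem[of "?l @ ?r"] L by (simp add: val_def)
  then have "pre w2 (orig x2) \<otimes> val ?r = pre w1 (orig x1) \<otimes> val ?r"
    using L pre_drop[OF w(1), of "orig x1"] state_value[OF 1] by (simp add: val_append pre_def)
  then show ?thesis using L w by simp
qed

lemma right_end_equal:
  assumes 1: "state w1 (P1 @ x1 # Q1)" and 2: "state w2 (P2 @ x2 # Q2)"
    and same: "letter x1 = letter x2" "hist x1 = hist x2" "map letter Q1 = map letter Q2"
  shows "pre w1 (orig x1) = pre w2 (orig x2)"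
proof -
  let ?l = "take (orig x1) w1" and ?r = "drop (orig x2) w2"
  have w: "w1 \<in> lists X" "w2 \<in> lists X" using 1 2 by (auto simp: state_def)
  note L = w[THEN lists_take] w[THEN lists_drop]
  have "(nca_step R)\<^sup>*\<^sup>* (?l @ ?r) (map letter (P1 @ x1 # Q2))"
    using splice_once[of R w1 P1 x1 Q1 w2 P2 x2 Q2] 1 2 same by (simp add: state_def)
  also have "map letter (P1 @ x1 # Q2) = map letter (P1 @ x1 # Q1)"
    using same by simp
  also have "(nca_step R)\<^sup>*\<^sup>* \<dots> []" using 1 by (simp add: state_def)
  finally have "val (?l @ ?r) = \<one>"
    using solves_word_problem[of "?l @ ?r"] L by (simp add: val_def)
  then have "pre w1 (orig x1) \<otimes> val ?r = pre w2 (orig x2) \<otimes> val ?r"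
    using L pre_drop[OF w(2), of "orig x2"] state_value[OF 2] by (simp add: val_append pre_def)
  then show ?thesis using L w by simp
qed

text \<open>The distance \<open>Suc V\<close> between the letters is the bound on the length of a left hand side, so that
two letters involved in one step are always this close.\<close>

definition gaps :: "nat \<Rightarrow> 'a set" where
  "gaps k = {val (drop (orig x) (take (orig y) w)) | w P x M y Q.
     state w (P @ x # M @ y # Q) \<and> length M \<le> Suc V \<and> length (hist x) \<le> k \<and> length (hist y) \<le> k}"

definition ends :: "nat \<Rightarrow> 'a set" where
  "ends k = {pre w (orig x) | w P x Q.
     state w (P @ x # Q) \<and> (length P \<le> Suc V \<or> length Q \<le> Suc V) \<and> length (hist x) \<le> k}"

definition traced_kinds :: "nat \<Rightarrow> ('b \<times> ('b rule \<times> nat \<times> nat) list) set" where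
  "traced_kinds k = A \<times> {h. set h \<subseteq> trace_marks (Suc V) \<and> length h \<le> k}"

definition kind :: "'b tletter \<Rightarrow> 'b \<times> ('b rule \<times> nat \<times> nat) list" where
  "kind x = (letter x, hist x)"

definition kind_bound :: "nat \<Rightarrow> nat" where
  "kind_bound k = card A * Suc (card (trace_marks (Suc V))) ^ k"

lemma finite_traced_kinds: "finite (traced_kinds k)"
  unfolding traced_kinds_def using finite_alphabet finite_trace_marks card_lists_le(1) by blast

lemma card_traced_kinds: "card (traced_kinds k) \<le> kind_bound k"
  unfolding traced_kinds_def kind_bound_def card_cartesian_product
  by (intro mult_le_mono card_lists_le finite_trace_marks) simp

lemma kind_mem: "state w Z \<Longrightarrow> x \<in> set Z \<Longrightarrow> length (hist x) \<le> k \<Longrightarrow> kind x \<in> traced_kinds k"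
  using state_letters by (auto simp: traced_kinds_def kind_def)

abbreviation short_words :: "'b list set" where
  "short_words \<equiv> {M. set M \<subseteq> A \<and> length M \<le> Suc V}"

text \<open>By \<open>slices_equal\<close> a gap between letters of different origin is determined by the symbols and
histories of the two letters and by the symbols between them. Letters of the same origin
contribute only the identity.\<close>

lemma card_gaps:
  "finite (gaps k)" "card (gaps k) \<le> Suc (kind_bound k * kind_bound k * Suc (card A) ^ Suc V)"
proof -
  define rel where "rel = (\<lambda>d e. \<exists>w P x M y Q. state w (P @ x # M @ y # Q) \<and>
    d = (kind x, kind y, map letter M) \<and> orig x < orig y \<and>
    e = val (drop (orig x) (take (orig y) w)))"
  let ?D = "traced_kinds k \<times> traced_kinds k \<times> short_words"
  let ?S = "gaps k - {\<one>}"
  have fin: "finite ?D" using finite_traced_kinds card_lists_le(1)[OF finite_alphabet] by blast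
  have ex: "\<exists>d\<in>?D. rel d e" if e: "e \<in> ?S" for e
  proof -
    obtain w P x M y Q where s: "state w (P @ x # M @ y # Q)" "length M \<le> Suc V"
        "length (hist x) \<le> k" "length (hist y) \<le> k"
        and e': "e = val (drop (orig x) (take (orig y) w))"
      using e unfolding gaps_def by blast
    have "orig x < orig y"
    proof (rule ccontr)
      assume "\<not> orig x < orig y"
      then have "e = \<one>" unfolding e' by simp
      then show False using e by simp
    qed
    then have "rel (kind x, kind y, map letter M) e"
      unfolding rel_def using s(1) e' by blast
    moreover have "(kind x, kind y, map letter M) \<in> ?D"
      using kind_mem[OF s(1)] state_letters[OF s(1)] s by auto
    ultimately show ?thesis by blast
  qed
  have func: "e = e'" if r1: "rel d e" and r2: "rel d e'" for d e e'
  proof -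
    obtain w P x M y Q where 1: "state w (P @ x # M @ y # Q)" "d = (kind x, kind y, map letter M)"
        "orig x < orig y" "e = val (drop (orig x) (take (orig y) w))"
      using r1 unfolding rel_def by blast
    obtain w' P' x' M' y' Q' where 2: "state w' (P' @ x' # M' @ y' # Q')"
        "d = (kind x', kind y', map letter M')"
        "orig x' < orig y'" "e' = val (drop (orig x') (take (orig y') w'))"
      using r2 unfolding rel_def by blast
    from 1(2) 2(2) have "letter x = letter x'" "hist x = hist x'" "letter y = letter y'"
        "hist y = hist y'" "map letter M = map letter M'"
      by (simp_all add: kind_def)
    then show ?thesis
      unfolding 1(4) 2(4) by (rule slices_equal[OF 1(1) 2(1) _ _ _ _ _ 1(3) 2(3)])
  qed
  note C = card_le_of_functional[where rel = rel, OF fin ex func]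
  have "finite ?S" by (rule C(1))
  have "card ?S \<le> card ?D" by (rule C(2))
  from \<open>finite ?S\<close> show "finite (gaps k)" by simp
  have "card (gaps k) \<le> Suc (card ?S)"
    by (simp add: card_Diff_singleton_if, arith)
  also have "card ?D \<le> kind_bound k * kind_bound k * Suc (card A) ^ Suc V"
    unfolding card_cartesian_product mult.assoc
    by (intro mult_le_mono card_traced_kinds card_lists_le finite_alphabet)
  then have "Suc (card ?S) \<le> Suc (kind_bound k * kind_bound k * Suc (card A) ^ Suc V)"
    using \<open>card ?S \<le> card ?D\<close> by linarith
  finally show "card (gaps k) \<le> Suc (kind_bound k * kind_bound k * Suc (card A) ^ Suc V)" .
qed

lemma card_ends:
  "finite (ends k)" "card (ends k) \<le> 2 * (kind_bound k * Suc (card A) ^ Suc V)"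
proof -
  define rel where "rel = (\<lambda>d e. \<exists>w P x Q c. state w (P @ x # Q) \<and>
    d = (c, kind x, map letter (if c then P else Q)) \<and> e = pre w (orig x))"
  let ?D = "(UNIV :: bool set) \<times> traced_kinds k \<times> short_words"
  have fin: "finite ?D" by (intro finite_cartesian_product finite_traced_kinds card_lists_le(1) finite_alphabet) simp
  have ex: "\<exists>d\<in>?D. rel d e" if e: "e \<in> ends k" for e
  proof -
    obtain w P x Q where s: "state w (P @ x # Q)" "length P \<le> Suc V \<or> length Q \<le> Suc V"
        "length (hist x) \<le> k" and e': "e = pre w (orig x)"
      using e unfolding ends_def by blast
    define c where "c \<longleftrightarrow> length P \<le> Suc V"
    have "rel (c, kind x, map letter (if c then P else Q)) e"
      unfolding rel_def using s(1) e' by blast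
    moreover have "(c, kind x, map letter (if c then P else Q)) \<in> ?D"
      using kind_mem[OF s(1)] state_letters[OF s(1)] s c_def by auto
    ultimately show ?thesis by blast
  qed
  have func: "e = e'" if r1: "rel d e" and r2: "rel d e'" for d e e'
  proof -
    obtain w P x Q c where 1: "state w (P @ x # Q)"
        "d = (c, kind x, map letter (if c then P else Q))" "e = pre w (orig x)"
      using r1 unfolding rel_def by blast
    obtain w' P' x' Q' where 2: "state w' (P' @ x' # Q')"
        "d = (c, kind x', map letter (if c then P' else Q'))" "e' = pre w' (orig x')"
      using r2 1(2) unfolding rel_def by (metis prod.inject)
    from 1(2) 2(2) have "letter x = letter x'" "hist x = hist x'"
        "map letter (if c then P else Q) = map letter (if c then P' else Q')"
      by (simp_all add: kind_def)
    then show ?thesis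
      unfolding 1(3) 2(3)
      using left_end_equal[OF 1(1) 2(1)] right_end_equal[OF 1(1) 2(1)] by (cases c) simp_all
  qed
  note C = card_le_of_functional[where rel = rel, OF fin ex func]
  show "finite (ends k)" by (rule C(1))
  have "card (ends k) \<le> card ?D" by (rule C(2))
  also have "\<dots> \<le> 2 * (kind_bound k * Suc (card A) ^ Suc V)"
    unfolding card_cartesian_product card_UNIV_bool
    by (intro mult_le_mono card_traced_kinds card_lists_le finite_alphabet order_refl)
  finally show "card (ends k) \<le> 2 * (kind_bound k * Suc (card A) ^ Suc V)" .
qed

end

section \<open>Chains of short multiplications in a group\<close>

context group
begin

text \<open>Multiplication is allowed on both sides: most of the time \<open>\<xi>\<close> is extended on the right, but
elements of \<open>H\<close> act on the left. Counting the elements at bounded distance does not suffer.\<close>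

definition link :: "'a set \<Rightarrow> 'a \<Rightarrow> 'a \<Rightarrow> bool" where
  "link Q x y \<longleftrightarrow> x \<in> carrier G \<and> y \<in> carrier G \<and>
     (x = y \<or> (\<exists>a\<in>Q. y = a \<otimes> x \<or> y = x \<otimes> a \<or> x = a \<otimes> y \<or> x = y \<otimes> a))"

abbreviation near :: "'a set \<Rightarrow> nat \<Rightarrow> 'a \<Rightarrow> 'a \<Rightarrow> bool" where
  "near Q k \<equiv> link Q ^^ k"

lemma link_sym: "link Q x y \<Longrightarrow> link Q y x"
  by (auto simp: link_def)

lemma near_sym: "near Q k x y \<Longrightarrow> near Q k y x"
proof (induction k arbitrary: x y)
  case (Suc k)
  then obtain z where "near Q k x z" "link Q z y" by auto
  then have "link Q y z" "near Q k z x" using Suc.IH link_sym by auto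
  then show ?case by (rule relpowp_Suc_I2)
qed auto

lemma near1: "link Q a b \<Longrightarrow> near Q 1 a b"
  by (simp only: relpowp_1)

lemma near_trans: "near Q j x y \<Longrightarrow> near Q k y z \<Longrightarrow> near Q (j + k) x z"
  by (auto simp: relpowp_add)

lemma near_refl: "x \<in> carrier G \<Longrightarrow> near Q k x x"
  by (induction k) (auto simp: link_def)

lemma near_closed: "near Q k x y \<Longrightarrow> x \<in> carrier G \<Longrightarrow> y \<in> carrier G"
  by (induction k arbitrary: y) (auto simp: link_def)

lemma near_mono:
  assumes "near Q j x y" "j \<le> k" "x \<in> carrier G"
  shows "near Q k x y"
proof -
  have "near Q (j + (k - j)) x y"
    using near_trans[OF assms(1) near_refl[OF near_closed[OF assms(1,3)]]] .
  then show ?thesis using assms(2) by simp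
qed

lemma card_near:
  assumes "finite Q" "Q \<subseteq> carrier G" "x \<in> carrier G"
  shows "finite {y. near Q k x y} \<and> card {y. near Q k x y} \<le> Suc (4 * card Q) ^ k"
proof (induction k)
  case (Suc k)
  let ?B = "{y. near Q k x y}"
  define nb where "nb z = {z} \<union> (\<lambda>a. a \<otimes> z) ` Q \<union> (\<lambda>a. z \<otimes> a) ` Q \<union>
     (\<lambda>a. inv a \<otimes> z) ` Q \<union> (\<lambda>a. z \<otimes> inv a) ` Q" for z
  have nb: "finite (nb z)" "card (nb z) \<le> Suc (4 * card Q)" for z
  proof -
    show "finite (nb z)" using assms by (simp add: nb_def)
    have "card (nb z) \<le> card {z} + card ((\<lambda>a. a \<otimes> z) ` Q) + card ((\<lambda>a. z \<otimes> a) ` Q) +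
       card ((\<lambda>a. inv a \<otimes> z) ` Q) + card ((\<lambda>a. z \<otimes> inv a) ` Q)"
      unfolding nb_def
      by (intro order_trans[OF card_Un_le] add_mono order_refl)
    also have "\<dots> \<le> 1 + card Q + card Q + card Q + card Q"
      by (intro add_mono card_image_le assms) simp
    finally show "card (nb z) \<le> Suc (4 * card Q)" by simp
  qed
  have lk: "y \<in> nb z" if "link Q z y" for z y
  proof -
    have c: "z \<in> carrier G" "y \<in> carrier G" using that by (auto simp: link_def)
    have "y = inv a \<otimes> z" if "a \<in> Q" "z = a \<otimes> y" for a
      using that c assms(2) by (metis inv_solve_left subsetD)
    moreover have "y = z \<otimes> inv a" if "a \<in> Q" "z = y \<otimes> a" for a
      using that c assms(2) by (metis inv_solve_right subsetD)
    ultimately show ?thesis using that unfolding link_def nb_def by blast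
  qed
  have sub: "{y. near Q (Suc k) x y} \<subseteq> (\<Union>z\<in>?B. nb z)"
    using lk by (auto elim!: relpowp_Suc_E)
  have fin: "finite (\<Union>z\<in>?B. nb z)" using Suc nb by blast
  have "card {y. near Q (Suc k) x y} \<le> card (\<Union>z\<in>?B. nb z)"
    by (rule card_mono[OF fin sub])
  also have "\<dots> \<le> (\<Sum>z\<in>?B. card (nb z))" using Suc by (intro card_UN_le) blast
  also have "\<dots> \<le> card ?B * Suc (4 * card Q)"
    using sum_bounded_above[of ?B "\<lambda>z. card (nb z)" "Suc (4 * card Q)"] nb(2) by simp
  also have "\<dots> \<le> Suc (4 * card Q) ^ k * Suc (4 * card Q)"
    using Suc by (intro mult_le_mono) auto
  finally show ?case using finite_subset[OF sub fin] by (simp add: mult.commute)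
qed auto

text \<open>From the first time jump to the last time of the same colour, take one step, and repeat: every
colour is used once.\<close>

lemma near_along_colours:
  assumes "finite C" "a \<le> T" "\<And>t. a \<le> t \<Longrightarrow> t \<le> T \<Longrightarrow> f t \<in> carrier G \<and> col t \<in> C"
    and "\<And>t. a \<le> t \<Longrightarrow> t < T \<Longrightarrow> near Q p (f t) (f (Suc t))"
    and "\<And>s t. a \<le> s \<Longrightarrow> s \<le> t \<Longrightarrow> t \<le> T \<Longrightarrow> col s = col t \<Longrightarrow> near Q q (f s) (f t)"
  shows "near Q ((p + q) * card C) (f a) (f T)"
  using assms
proof (induction "card C" arbitrary: C a)
  case 0
  then show ?case by (metis card_0_eq empty_iff order_refl)
next
  case (Suc n)
  define s where "s = Max {t. a \<le> t \<and> t \<le> T \<and> col t = col a}"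
  have "s \<in> {t. a \<le> t \<and> t \<le> T \<and> col t = col a}"
    unfolding s_def by (rule Max_in) (use Suc.prems in \<open>auto intro: finite_subset[of _ "{..T}"]\<close>)
  then have s: "a \<le> s" "s \<le> T" "col s = col a" by auto
  have last: "t \<le> s" if "a \<le> t" "t \<le> T" "col t = col a" for t
    unfolding s_def by (rule Max_ge) (use that in \<open>auto intro: finite_subset[of _ "{..T}"]\<close>)
  have as: "near Q q (f a) (f s)" using Suc.prems(5)[of a s] s by simp
  have ca: "f a \<in> carrier G" using Suc.prems by simp
  show ?case
  proof (cases "s = T")
    case True
    have "q \<le> (p + q) * card C" using Suc(2) by (metis le_add1 le_add2 mult_Suc_right order_trans)
    then show ?thesis using near_mono[OF as _ ca] True by simp
  next
    case False
    then have "s < T" using s by simp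
    have "near Q ((p + q) * card (C - {col a})) (f (Suc s)) (f T)"
    proof (rule Suc.hyps(1))
      show "n = card (C - {col a})" using Suc.hyps(2) Suc.prems(1,2,3) by simp
      show "f t \<in> carrier G \<and> col t \<in> C - {col a}" if "Suc s \<le> t" "t \<le> T" for t
        using that last[of t] Suc.prems(3)[of t] s by auto
    qed (use Suc.prems s \<open>s < T\<close> in auto)
    from near_trans[OF near_trans[OF as Suc.prems(4)[of s]] this] s \<open>s < T\<close>
    have "near Q (q + p + (p + q) * card (C - {col a})) (f a) (f T)" by simp
    also have "q + p + (p + q) * card (C - {col a}) = (p + q) * card C"
      using Suc.hyps(2) Suc.prems(1,2,3) by (simp add: algebra_simps flip: Suc.hyps(2))
    finally show ?thesis .
  qed
qed

end

section \<open>The commutator word of two commuting elements\<close>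

text \<open>The last assumption guarantees that no letter in a reduction of the commutator word has a
history of length \<open>k\<close> or more.\<close>

locale commutator_words = cannon_group G X A R ev V
  for G :: "('a, 'm) monoid_scheme" (structure) and X A :: "'b set" and R :: "'b rule set"
    and ev :: "'b \<Rightarrow> 'a" and V :: nat +
  fixes g :: 'a and u ubar :: "'b list" and H :: "'a set" and v vbar :: "'a \<Rightarrow> 'b list"
    and l k :: nat
  assumes g: "g \<in> carrier G"
    and u: "u \<in> lists X" "u \<noteq> []" "length u \<le> l" "val u = g"
    and ubar: "ubar \<in> lists X" "ubar \<noteq> []" "length ubar \<le> l" "val ubar = inv g"
    and H: "finite H" "H \<subseteq> carrier G"
    and v: "h \<in> H \<Longrightarrow> v h \<in> lists X \<and> v h \<noteq> [] \<and> length (v h) \<le> l \<and> val (v h) = h"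
    and vbar: "h \<in> H \<Longrightarrow> vbar h \<in> lists X \<and> length (vbar h) \<le> l \<and> val (vbar h) = inv h"
    and commute: "h \<in> H \<Longrightarrow> g \<otimes> h = h \<otimes> g"
    and young: "(V / Suc V) ^ k * (Suc V * (4 * l)) < (1 :: real)"
begin

text \<open>The prefixes of the words for \<open>h\<close> and its inverse are included because a boundary letter that
comes from one of these words pins down the value of the input only up to such a prefix. In
particular \<open>H\<close> itself is included. Nothing here depends on \<open>g\<close>, so that one set serves all
elements of \<open>S1 n\<close>.\<close>

definition pieces :: "'a set" where
  "pieces = gaps k \<union> ends k \<union> (\<lambda>(h, i). pre (v h) i) ` (H \<times> {..l}) \<union> (\<lambda>(h, i). pre (vbar h) i) ` (H \<times> {..l})"

definition word :: "'a \<Rightarrow> 'b list" where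
  "word h = u @ v h @ ubar @ vbar h"

definition c1 :: nat where "c1 = length u"
definition c2 :: "'a \<Rightarrow> nat" where "c2 h = c1 + length (v h)"
definition c3 :: "'a \<Rightarrow> nat" where "c3 h = c2 h + length ubar"

lemma hH: "h \<in> H \<Longrightarrow> h \<in> carrier G"
  using H by blast

lemma word_lists: "h \<in> H \<Longrightarrow> word h \<in> lists X"
  using u ubar v vbar by (simp add: word_def)

text \<open>Commutation makes the value of \<open>u v ubar\<close> independent of \<open>g\<close>. Hence the commutator word is
trivial, and the values at the letters of \<open>vbar\<close> involve \<open>h\<close> only.\<close>

lemma conj_g: "h \<in> H \<Longrightarrow> g \<otimes> (h \<otimes> inv g) = h"
  using g hH[of h] commute[of h] by (metis inv_closed inv_solve_right m_assoc m_closed)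

lemma val_word: "h \<in> H \<Longrightarrow> val (word h) = \<one>"
  using u ubar v[of h] vbar[of h] g hH[of h] conj_g[of h]
  by (simp add: word_def val_append m_assoc[symmetric])

lemma length_word: "h \<in> H \<Longrightarrow> length (word h) \<le> 4 * l"
  using u ubar v[of h] vbar[of h] by (simp add: word_def)

lemma pre_append:
  "a \<in> lists X \<Longrightarrow> b \<in> lists X \<Longrightarrow> length a \<le> q \<Longrightarrow> pre (a @ b) q = val a \<otimes> pre b (q - length a)"
  by (simp add: pre_def val_append lists_take)

lemma pre_word_u: "q < c1 \<Longrightarrow> pre (word h) q = pre u q"
  by (simp add: pre_def word_def c1_def)

lemma pre_word_v:
  assumes "h \<in> H" "c1 \<le> q" "q < c2 h"
  shows "pre (word h) q = g \<otimes> pre (v h) (q - c1)"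
proof -
  have "pre (word h) q = g \<otimes> pre (v h @ ubar @ vbar h) (q - c1)"
    unfolding word_def using assms u ubar v vbar by (subst pre_append) (auto simp: c1_def)
  also have "pre (v h @ ubar @ vbar h) (q - c1) = pre (v h) (q - c1)"
    using assms by (simp add: pre_def c2_def)
  finally show ?thesis .
qed

lemma pre_word_ubar:
  assumes "h \<in> H" "c2 h \<le> q" "q < c3 h"
  shows "pre (word h) q = g \<otimes> (h \<otimes> pre ubar (q - c2 h))"
proof -
  have "pre (word h) q = g \<otimes> pre (v h @ ubar @ vbar h) (q - c1)"
    unfolding word_def using assms u ubar v vbar by (subst pre_append) (auto simp: c1_def c2_def)
  also have "pre (v h @ ubar @ vbar h) (q - c1) = h \<otimes> pre (ubar @ vbar h) (q - c2 h)"
    using assms u ubar v[of h] vbar[of h] by (subst pre_append) (auto simp: c2_def)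
  also have "pre (ubar @ vbar h) (q - c2 h) = pre ubar (q - c2 h)"
    using assms by (simp add: pre_def c3_def)
  finally show ?thesis .
qed

lemma pre_word_vbar:
  assumes "h \<in> H" "c3 h \<le> q"
  shows "pre (word h) q = h \<otimes> pre (vbar h) (q - c3 h)"
proof -
  have "word h = (u @ v h @ ubar) @ vbar h" by (simp add: word_def)
  moreover have "val (u @ v h @ ubar) = h"
    using u ubar v[OF assms(1)] conj_g[OF assms(1)] by (simp add: val_append)
  ultimately show ?thesis
    using assms u ubar v[OF assms(1)] vbar[OF assms(1)]
    by (simp only:) (subst pre_append, auto simp: c1_def c2_def c3_def add.assoc)
qed

lemma finite_pieces: "finite pieces"
  using card_gaps(1) card_ends(1) H(1) by (simp add: pieces_def)

lemma card_pieces: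
  "card pieces \<le> Suc (kind_bound k * kind_bound k * Suc (card A) ^ Suc V)
     + 2 * (kind_bound k * Suc (card A) ^ Suc V) + 2 * (card H * Suc l)"
proof -
  have "card ((\<lambda>(h, i). f h i) ` (H \<times> {..l})) \<le> card H * Suc l" for f :: "'a \<Rightarrow> nat \<Rightarrow> 'a"
    using card_image_le[of "H \<times> {..l}" "\<lambda>(h, i). f h i"] H(1) by (simp add: card_cartesian_product)
  from add_mono[OF this[of "\<lambda>h. pre (v h)"] this[of "\<lambda>h. pre (vbar h)"]]
  have "card ((\<lambda>(h, i). pre (v h) i) ` (H \<times> {..l})) + card ((\<lambda>(h, i). pre (vbar h) i) ` (H \<times> {..l}))
      \<le> 2 * (card H * Suc l)"
    by (simp only: mult_2)
  moreover have "card pieces \<le> card (gaps k) + card (ends k) + card ((\<lambda>(h, i). pre (v h) i) ` (H \<times> {..l}))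
      + card ((\<lambda>(h, i). pre (vbar h) i) ` (H \<times> {..l}))"
    unfolding pieces_def by (intro order_trans[OF card_Un_le] add_mono order_refl)
  ultimately show ?thesis using card_gaps(2)[of k] card_ends(2)[of k] by linarith
qed

lemma pieces_closed: "pieces \<subseteq> carrier G"
  unfolding pieces_def gaps_def ends_def state_def
  using v vbar by (auto intro!: val_closed pre_closed lists_drop lists_take)

lemma link_gap:
  assumes "state w (P @ x # M @ y # Z)" "length M \<le> Suc V" "length (hist x) \<le> k" "length (hist y) \<le> k"
  shows "link pieces (pre w (orig x)) (pre w (orig y))"
proof -
  have w: "w \<in> lists X" using assms(1) by (simp add: state_def)
  have "orig x \<le> orig y"
    using state_sorted[OF assms(1)] by (simp add: sorted_append)
  from pre_slice[OF w this]
  have "pre w (orig y) = pre w (orig x) \<otimes> val (drop (orig x) (take (orig y) w))" .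
  moreover have "val (drop (orig x) (take (orig y) w)) \<in> pieces"
    unfolding pieces_def gaps_def using assms by blast
  ultimately show ?thesis using w unfolding link_def by blast
qed

lemma link_end:
  assumes "state w (P @ x # Z)" "length P \<le> Suc V \<or> length Z \<le> Suc V" "length (hist x) \<le> k"
  shows "link pieces (pre w (orig x)) \<one>"
proof -
  have w: "w \<in> lists X" using assms(1) by (simp add: state_def)
  have "pre w (orig x) \<in> pieces" unfolding pieces_def ends_def using assms by blast
  moreover have "pre w (orig x) = \<one> \<otimes> pre w (orig x)" using w by simp
  ultimately show ?thesis using w unfolding link_def by blast
qed

lemma pre_beyond: "pre w q = pre w (min q (length w))"
  by (simp add: pre_def min_def)

lemma link_v:
  assumes "h \<in> H" "x \<in> carrier G"
  shows "link pieces x (x \<otimes> pre (v h) i)" "link pieces x (x \<otimes> pre (vbar h) i)"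
    "link pieces x (h \<otimes> x)"
proof -
  have lv: "v h \<in> lists X" "vbar h \<in> lists X" "length (v h) \<le> l" "length (vbar h) \<le> l" "val (v h) = h"
    using v[OF assms(1)] vbar[OF assms(1)] by auto
  have "(h, min j (length (v h))) \<in> H \<times> {..l}" for j
    using assms(1) lv by auto
  from imageI[OF this, of "\<lambda>(h, i). pre (v h) i"]
  have "pre (v h) (min j (length (v h))) \<in> pieces" for j by (simp add: pieces_def)
  then have 1: "pre (v h) j \<in> pieces" for j using pre_beyond by metis
  have "(h, min i (length (vbar h))) \<in> H \<times> {..l}"
    using assms(1) lv by auto
  from imageI[OF this, of "\<lambda>(h, i). pre (vbar h) i"]
  have "pre (vbar h) (min i (length (vbar h))) \<in> pieces" by (simp add: pieces_def)
  then have 2: "pre (vbar h) i \<in> pieces" using pre_beyond by metis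
  have 3: "h \<in> pieces" using 1[of "length (v h)"] lv by (simp add: pre_def)
  show "link pieces x (x \<otimes> pre (v h) i)" "link pieces x (x \<otimes> pre (vbar h) i)"
      "link pieces x (h \<otimes> x)"
    using 1 2 3 assms lv hH[OF assms(1)] unfolding link_def by (blast intro: m_closed pre_closed)+
qed

end

section \<open>The moving boundary between a word and its inverse\<close>

locale commutator_runs = commutator_words G X A R ev V g u ubar H v vbar l k
  for G :: "('a, 'm) monoid_scheme" (structure) and X A :: "'b set" and R :: "'b rule set"
    and ev :: "'b \<Rightarrow> 'a" and V :: nat and g :: 'a and u ubar :: "'b list" and H :: "'a set"
    and v vbar :: "'a \<Rightarrow> 'b list" and l k :: nat +
  fixes Z :: "'a \<Rightarrow> nat \<Rightarrow> 'b tletter list" and len :: "'a \<Rightarrow> nat"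
  assumes run: "h \<in> H \<Longrightarrow> Z h 0 = start (word h)" "h \<in> H \<Longrightarrow> Z h (len h) = []"
    "h \<in> H \<Longrightarrow> t < len h \<Longrightarrow> tstep R (Z h t) (Z h (Suc t))"
begin

lemma state_run:
  assumes "h \<in> H" "t \<le> len h"
  shows "state (word h) (Z h t)"
proof -
  have "(tstep R)\<^sup>*\<^sup>* (start (word h)) (Z h t)"
    using assms(2)
  proof (induction t)
    case 0
    then show ?case using run(1)[OF assms(1)] by simp
  next
    case (Suc t)
    then show ?case using run(3)[OF assms(1), of t] by (simp add: rtranclp.rtrancl_into_rtrancl)
  qed
  moreover have "(tstep R)\<^sup>*\<^sup>* (Z h t) (Z h (len h))"
    using assms(2)
  proof (induction t rule: inc_induct)
    case (step t)
    then show ?case using run(3)[OF assms(1), of t] by (simp add: converse_rtranclp_into_rtranclp)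
  qed simp
  ultimately show ?thesis
    using run(2)[OF assms(1)] tsteps_imp_nca_steps[of R "Z h t" "[]"] word_lists[OF assms(1)]
    by (simp add: state_def)
qed

lemmas sorted_run = state_sorted[OF state_run]

lemma old_letters:
  assumes "h \<in> H"
  shows "finite {x. \<exists>t\<le>len h. x \<in> set (Z h t) \<and> j \<le> length (hist x)}"
    and "real (card {x. \<exists>t\<le>len h. x \<in> set (Z h t) \<and> j \<le> length (hist x)})
       \<le> (V / Suc V) ^ j * (Suc V * (4 * l))"
proof -
  note F = few_old_letters[of V "Z h" "word h" "len h", OF short_rules run(1)[OF assms] run(3)[OF assms]]
  show "finite {x. \<exists>t\<le>len h. x \<in> set (Z h t) \<and> j \<le> length (hist x)}" by (rule F(1))
  have "real (Suc V * length (word h)) \<le> real (Suc V * (4 * l))"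
    using length_word[OF assms] by (metis mult_le_mono2 of_nat_le_iff)
  then have "(V / Suc V) ^ j * real (Suc V * length (word h)) \<le> (V / Suc V) ^ j * real (Suc V * (4 * l))"
    by (intro mult_left_mono) auto
  then show "real (card {x. \<exists>t\<le>len h. x \<in> set (Z h t) \<and> j \<le> length (hist x)})
       \<le> (V / Suc V) ^ j * (Suc V * (4 * l))"
    using F(2)[of j] by linarith
qed

lemma young_letters:
  assumes "h \<in> H" "t \<le> len h" "x \<in> set (Z h t)"
  shows "length (hist x) < k"
proof (rule ccontr)
  assume old: "\<not> ?thesis"
  let ?S = "{x. \<exists>t\<le>len h. x \<in> set (Z h t) \<and> k \<le> length (hist x)}"
  have "real (card ?S) < 1" using old_letters(2)[OF assms(1), of k] young by linarith
  then have "card ?S = 0" by simp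
  then have "?S = {}" using old_letters(1)[OF assms(1), of k] by simp
  moreover have "x \<in> ?S" using old assms by auto
  ultimately show False by blast
qed

definition alive :: "'a \<Rightarrow> nat \<Rightarrow> bool" where
  "alive h t \<longleftrightarrow> below c1 (Z h t) \<noteq> [] \<and> (\<exists>y\<in>set (Z h t). c2 h \<le> orig y \<and> orig y < c3 h)"

text \<open>Time 0 is alive, so the least time that is not alive is positive and the subtraction is exact.\<close>

definition last_alive :: "'a \<Rightarrow> nat" where
  "last_alive h = (LEAST t. \<not> alive h t) - 1"

definition left_letter where "left_letter h t = last (below c1 (Z h t))"
definition right_letter where "right_letter h t = hd (above c1 (Z h t))"
definition xi where "xi h t = pre (word h) (orig (left_letter h t))"
text \<open>The letter to the right of the boundary still comes from \<open>v\<close>.\<close>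

definition start_time where "start_time h t \<longleftrightarrow> orig (right_letter h t) < c2 h"

lemma start_letter: "h \<in> H \<Longrightarrow> q < length (word h) \<Longrightarrow> \<exists>z\<in>set (Z h 0). orig z = q"
  using nth_mem[of q "start (word h)"] run(1) by (metis length_start nth_start tletter.sel(1))

lemma alive_start: "h \<in> H \<Longrightarrow> alive h 0"
proof -
  assume h: "h \<in> H"
  have "0 < c1" "c1 \<le> length (word h)" "c2 h < c3 h" "c3 h \<le> length (word h)"
    using u(2) ubar(2) by (auto simp: c1_def c2_def c3_def word_def)
  then obtain a b where "a \<in> set (Z h 0)" "orig a = 0" "b \<in> set (Z h 0)" "orig b = c2 h"
    using start_letter[OF h, of 0] start_letter[OF h, of "c2 h"] by force
  then show ?thesis
    using \<open>0 < c1\<close> \<open>c2 h < c3 h\<close> unfolding alive_def below_def filter_empty_conv by force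
qed

lemma last_alive:
  assumes "h \<in> H"
  shows "last_alive h < len h" "t \<le> last_alive h \<Longrightarrow> alive h t" "\<not> alive h (Suc (last_alive h))"
proof -
  have "\<not> alive h (len h)" using run(2)[OF assms] by (simp add: alive_def below_def)
  note L = LeastI[of "\<lambda>t. \<not> alive h t", OF this] Least_le[of "\<lambda>t. \<not> alive h t", OF this]
  have pos: "(LEAST t. \<not> alive h t) \<noteq> 0"
    using L(1) alive_start[OF assms] by metis
  then have S: "Suc (last_alive h) = (LEAST t. \<not> alive h t)" by (simp add: last_alive_def)
  show "last_alive h < len h" using L(2) S by simp
  show "\<not> alive h (Suc (last_alive h))" using L(1) S by simp
  show "alive h t" if "t \<le> last_alive h"
    using not_less_Least[of t "\<lambda>t. \<not> alive h t"] that S by simp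
qed

lemma split_run:
  assumes "h \<in> H" "t \<le> last_alive h"
  shows "Z h t = butlast (below c1 (Z h t)) @ left_letter h t # right_letter h t # tl (above c1 (Z h t))"
    and "orig (left_letter h t) < c1" "c1 \<le> orig (right_letter h t)" "orig (right_letter h t) < c3 h"
    and "left_letter h t \<in> set (Z h t)" "right_letter h t \<in> set (Z h t)"
proof -
  have le: "t \<le> len h" using assms last_alive(1) by (meson le_trans less_imp_le_nat)
  note s = sorted_run[OF assms(1) le]
  obtain b where b: "b \<in> set (Z h t)" "c2 h \<le> orig b" "orig b < c3 h" and ne: "below c1 (Z h t) \<noteq> []"
    using last_alive(2)[OF assms] by (auto simp: alive_def)
  have cb: "c1 \<le> orig b" using b(2) by (simp add: c2_def)
  note hd = orig_hd_above_le[OF s b(1) cb]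
  show "c1 \<le> orig (right_letter h t)" "orig (right_letter h t) < c3 h"
    using hd b(3) by (auto simp: right_letter_def)
  have "left_letter h t \<in> set (below c1 (Z h t))" unfolding left_letter_def using ne by (rule last_in_set)
  then show "orig (left_letter h t) < c1" by (simp add: below_def)
  have 1: "below c1 (Z h t) = butlast (below c1 (Z h t)) @ [left_letter h t]" using ne by (simp add: left_letter_def)
  have 2: "above c1 (Z h t) = right_letter h t # tl (above c1 (Z h t))" using hd(1) by (simp add: right_letter_def)
  show Z: "Z h t = butlast (below c1 (Z h t)) @ left_letter h t # right_letter h t # tl (above c1 (Z h t))"
    using below_above[OF s, of c1] 1 2 by (metis append.assoc append_Cons append_Nil)
  show "left_letter h t \<in> set (Z h t)" "right_letter h t \<in> set (Z h t)"
    by (subst Z, simp)+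
qed

lemma run_le: "h \<in> H \<Longrightarrow> t \<le> last_alive h \<Longrightarrow> t \<le> len h"
  using last_alive(1) by (meson le_trans less_imp_le_nat)

lemma link_run:
  assumes "h \<in> H" "t \<le> len h" "Z h t = P @ a # M @ b # Y" "length M \<le> Suc V"
  shows "link pieces (pre (word h) (orig a)) (pre (word h) (orig b))"
  using link_gap[of "word h" P a M b Y] state_run[OF assms(1,2)] assms
    young_letters[OF assms(1,2), of a] young_letters[OF assms(1,2), of b] by simp

lemma xi_closed: "h \<in> H \<Longrightarrow> xi h t \<in> carrier G"
  by (simp add: xi_def word_lists)

lemma link_xy:
  assumes "h \<in> H" "t \<le> last_alive h"
  shows "link pieces (xi h t) (pre (word h) (orig (right_letter h t)))"
  unfolding xi_def
  by (rule link_run[OF assms(1) run_le[OF assms], where M = "[]"])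
    (use split_run(1)[OF assms] in \<open>simp_all only: append_Nil list.size le0\<close>)

lemma xi_step:
  assumes "h \<in> H" "t < last_alive h"
  shows "near pieces 1 (xi h t) (xi h (Suc t))"
proof -
  have t: "t \<le> len h" "t < len h" "t \<le> last_alive h" "Suc t \<le> last_alive h"
    using assms last_alive(1)[of h] by auto
  have ne: "below c1 (Z h t) \<noteq> []" "below c1 (Z h (Suc t)) \<noteq> []"
    using last_alive(2)[OF assms(1)] t by (auto simp: alive_def)
  from last_below_step[OF run(3)[OF assms(1) t(2)] sorted_run[OF assms(1) t(1)] ne short_rules]
  consider "orig (left_letter h (Suc t)) = orig (left_letter h t)"
    | P z M Y where "Z h t = P @ z # M @ left_letter h t # Y" "orig z = orig (left_letter h (Suc t))" "length M \<le> Suc V"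
    unfolding left_letter_def by blast
  then show ?thesis
  proof cases
    case 1
    then show ?thesis using near_refl[OF xi_closed[OF assms(1), of t], where Q = pieces and k = 1] by (simp only: xi_def)
  next
    case 2
    from link_sym[OF link_run[OF assms(1) t(1) 2(1,3)]]
    show ?thesis unfolding xi_def 2(2) by (rule near1)
  qed
qed

text \<open>The letter right of the boundary sits at a value \<open>g c\<close> with \<open>c\<close> a prefix of \<open>v\<close>, which is one
piece away from \<open>g\<close>.\<close>

lemma start_time_near:
  assumes "h \<in> H" "t \<le> last_alive h" "start_time h t"
  shows "near pieces 2 (xi h t) g"
proof -
  have "pre (word h) (orig (right_letter h t)) = g \<otimes> pre (v h) (orig (right_letter h t) - c1)"
    using split_run[OF assms(1,2)] assms(3) by (intro pre_word_v[OF assms(1)]) (auto simp: start_time_def)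
  then have "link pieces g (pre (word h) (orig (right_letter h t)))"
    using link_v(1)[OF assms(1) g] by simp
  from near_trans[OF near1[OF link_xy[OF assms(1,2)]] near1[OF link_sym[OF this]]]
  show ?thesis by (simp only: one_add_one)
qed

lemma start_time_0: "h \<in> H \<Longrightarrow> start_time h 0"
proof -
  assume h: "h \<in> H"
  have "c1 < c2 h" "c2 h \<le> length (word h)"
    using v[OF h] by (auto simp: c1_def c2_def word_def)
  then obtain a where a: "a \<in> set (Z h 0)" "orig a = c1" using start_letter[OF h, of c1] by auto
  then show ?thesis
    using orig_hd_above_le(3)[OF sorted_run[OF h, of 0] a(1), of c1] \<open>c1 < c2 h\<close>
    by (simp add: start_time_def right_letter_def)
qed

text \<open>The step that ends the period removes all letters of \<open>u\<close> or all letters of \<open>ubar\<close>, so just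
before it these letters fit into one left hand side. If they come from \<open>u\<close>, the boundary
is near the beginning of the word. If they come from \<open>ubar\<close>, a bounded distance leads from the
first of them, \<open>b\<close>, to the end of the word or to a letter from \<open>vbar\<close>, where the value is
\<open>h\<close> times a prefix of \<open>vbar\<close>; and the boundary is reached from \<open>b\<close> through the letter \<open>a\<close>
before it, possibly by way of \<open>g\<close> when letters from \<open>v\<close> are still present.\<close>

lemma xi_end:
  assumes h: "h \<in> H"
  shows "near pieces 7 (xi h (last_alive h)) \<one>"
proof -
  let ?t = "last_alive h"
  have le: "?t \<le> last_alive h" "?t < len h" "?t \<le> len h" using last_alive(1)[OF h] by auto
  note s = sorted_run[OF h le(3)] and sp = split_run[OF h le(1)]
  have alive: "below c1 (Z h ?t) \<noteq> []" "\<exists>b\<in>set (Z h ?t). c2 h \<le> orig b \<and> orig b < c3 h"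
    using last_alive(2)[OF h le(1)] by (auto simp: alive_def)
  from run(3)[OF h le(2)] obtain \<rho> P L Y i where
    st: "Z h ?t = P @ L @ Y" "Z h (Suc ?t) = P @ offspring \<rho> i (L ! i) @ Y" "\<rho> \<in> R" "map letter L = lhs \<rho>"
    by cases metis
  have len: "length L \<le> Suc V" using short_rules[OF st(3)] st(4) by (metis length_map)
  have cx: "xi h ?t \<in> carrier G" using xi_closed[OF h] .
  consider (left) "below c1 (Z h (Suc ?t)) = []"
    | (right) "\<not> (\<exists>b\<in>set (Z h (Suc ?t)). c2 h \<le> orig b \<and> orig b < c3 h)"
    using last_alive(3)[OF h] by (auto simp: alive_def)
  then show ?thesis
  proof cases
    case left
    then have "below c1 (Z h ?t) = below c1 L" by (simp add: st(1,2))
    then have "length (below c1 (Z h ?t)) \<le> Suc V"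
      using len by (simp add: below_def) (meson le_trans length_filter_le)
    then have "length (butlast (below c1 (Z h ?t))) \<le> Suc V" by simp
    moreover have "state (word h) (butlast (below c1 (Z h ?t)) @ left_letter h ?t # right_letter h ?t # tl (above c1 (Z h ?t)))"
      using state_run[OF h le(3)] sp(1) by simp
    ultimately have "link pieces (pre (word h) (orig (left_letter h ?t))) \<one>"
      using link_end young_letters[OF h le(3) sp(5)] by (meson less_imp_le_nat)
    then have "near pieces 1 (xi h ?t) \<one>" unfolding xi_def by (rule near1)
    then show ?thesis by (rule near_mono) (use cx in auto)
  next
    case right
    define mid where "mid = filter (\<lambda>z :: 'b tletter. c2 h \<le> orig z \<and> orig z < c3 h)"
    have "mid P = []" "mid Y = []"
      using right by (auto simp: st(2) mid_def filter_empty_conv)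
    then have "mid (Z h ?t) = mid L" by (simp add: st(1) mid_def)
    then have lenmid: "length (mid (Z h ?t)) \<le> Suc V"
      using len by (simp add: mid_def) (meson le_trans length_filter_le)
    have midne: "mid (Z h ?t) \<noteq> []" using alive(2) by (auto simp: mid_def filter_empty_conv)
    define b where "b = hd (mid (Z h ?t))"
    have b: "b \<in> set (Z h ?t)"
      using hd_in_set[OF midne] by (simp add: b_def mid_def)
    have ab: "above (c2 h) (Z h ?t) = b # tl (mid (Z h ?t)) @ above (c3 h) (Z h ?t)"
      using above_split[OF _ s, of "c2 h" "c3 h"] midne by (simp add: c3_def mid_def b_def)
    \<comment> \<open>The letter before \<open>b\<close>; it comes from \<open>u\<close> or from \<open>v\<close>.\<close>
    define a where "a = last (below (c2 h) (Z h ?t))"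
    have c12: "c1 \<le> c2 h" by (simp add: c2_def)
    note bs = below_split[OF c12 s]
    have bne: "below (c2 h) (Z h ?t) \<noteq> []" using bs alive(1) by simp
    then have "below (c2 h) (Z h ?t) = butlast (below (c2 h) (Z h ?t)) @ [a]" by (simp add: a_def)
    then have Za: "Z h ?t = butlast (below (c2 h) (Z h ?t)) @ a # b # tl (mid (Z h ?t)) @ above (c3 h) (Z h ?t)"
      using below_above[OF s, of "c2 h"] ab by (metis append.assoc append_Cons append_Nil)
    let ?pa = "pre (word h) (orig a)" and ?pb = "pre (word h) (orig b)"
    have "link pieces ?pa ?pb"
      by (rule link_run[OF h le(3), where M = "[]"]) (use Za in \<open>simp_all only: append_Nil list.size le0\<close>)
    then have pab: "near pieces 1 ?pa ?pb" by (rule near1)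
    have "near pieces 3 (xi h ?t) ?pa"
    proof (cases "filter (\<lambda>z. c1 \<le> orig z \<and> orig z < c2 h) (Z h ?t) = []")
      case True
      then have "a = left_letter h ?t" using bs by (simp add: a_def left_letter_def)
      then show ?thesis using near_refl[OF cx, where Q = pieces and k = 3] by (simp add: xi_def)
    next
      case False
      then have "a \<in> set (filter (\<lambda>z. c1 \<le> orig z \<and> orig z < c2 h) (Z h ?t))"
        using last_in_set[OF False] unfolding a_def bs last_append by (simp only: False if_False)
      then have a: "a \<in> set (Z h ?t)" "c1 \<le> orig a" "orig a < c2 h" by auto
      have "start_time h ?t"
        using orig_hd_above_le(3)[OF s a(1,2)] a(3) by (simp add: start_time_def right_letter_def)
      note S = start_time_near[OF h le(1) this]
      have "link pieces g ?pa"
        using link_v(1)[OF h g, of "orig a - c1"] pre_word_v[OF h a(2,3)] by simp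
      from near_trans[OF S near1[OF this]] show ?thesis by simp
    qed
    moreover have "near pieces 3 ?pb \<one>"
    proof (cases "above (c3 h) (Z h ?t)")
      case Nil
      then have "state (word h) ((butlast (below (c2 h) (Z h ?t)) @ [a]) @ b # tl (mid (Z h ?t)))"
        using state_run[OF h le(3)] Za by simp
      moreover have "length (tl (mid (Z h ?t))) \<le> Suc V" using lenmid by simp
      ultimately have "link pieces ?pb \<one>"
        using link_end young_letters[OF h le(3) b] by (meson less_imp_le_nat)
      from near_mono[OF near1[OF this], where k = 3] show ?thesis using word_lists[OF h] by simp
    next
      case (Cons z Y')
      let ?pz = "pre (word h) (orig z)"
      have "c3 h \<le> orig z"
      proof -
        have "z \<in> set (above (c3 h) (Z h ?t))" using Cons by simp
        then show ?thesis unfolding above_def by simp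
      qed
      have l1: "link pieces ?pb ?pz"
        by (rule link_run[OF h le(3), where M = "tl (mid (Z h ?t))" and P = "butlast (below (c2 h) (Z h ?t)) @ [a]" and Y = Y'])
          (use Za Cons lenmid in simp_all)
      have l2: "link pieces h ?pz"
        using link_v(2)[OF h hH[OF h]] pre_word_vbar[OF h \<open>c3 h \<le> orig z\<close>] by simp
      have "link pieces \<one> h"
        using link_v(3)[OF h one_closed] hH[OF h] by simp
      from near_trans[OF near1[OF l1] near_trans[OF near1[OF link_sym[OF l2]] near1[OF link_sym[OF this]]]]
      show ?thesis by (simp add: numeral_3_eq_3)
    qed
    ultimately have "near pieces (3 + (1 + 3)) (xi h ?t) \<one>"
      using pab near_trans by blast
    then show ?thesis by simp
  qed
qed

end

section \<open>Colouring the steps of a derivation\<close>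

text \<open>The colour \<open>Start\<close> is for times at which letters from \<open>v\<close> are present at the boundary. The next
two single out boundary letters with long histories; the last two carry a key, respectively
the centre to which a key is assigned.\<close>

datatype ('x, 'k) colour = Start | Old_left 'x | Old_right 'x | Poor 'k | Rich 'k

context commutator_runs
begin

definition eta where "eta h t = pre (word h) (orig (right_letter h t))"
definition key where "key h t = (orig (left_letter h t), kind (left_letter h t), kind (right_letter h t))"

text \<open>The boundary lies between two letters with histories shorter than \<open>j\<close>, the left one from \<open>u\<close> and
the right one from \<open>ubar\<close>. Only then is the number of possible histories small compared
with the size of \<open>H\<close>.\<close>

definition low :: "nat \<Rightarrow> 'a \<Rightarrow> nat \<Rightarrow> bool" where
  "low j h t \<longleftrightarrow> t \<le> last_alive h \<and> \<not> start_time h t \<and> length (hist (left_letter h t)) < j \<and> length (hist (right_letter h t)) < j"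

definition visitors where "visitors j q = {h \<in> H. \<exists>t. low j h t \<and> key h t = q}"

definition slots where
  "slots j q = {orig (right_letter h t) - c2 h | h t. h \<in> H \<and> low j h t \<and> key h t = q}"

definition keys where "keys j = {..<l} \<times> traced_kinds j \<times> traced_kinds j"

lemma finite_keys: "finite (keys j)" "card (keys j) \<le> l * (kind_bound j * kind_bound j)"
  unfolding keys_def card_cartesian_product
  by (intro finite_cartesian_product finite_traced_kinds finite_lessThan)
    (intro mult_le_mono card_traced_kinds, simp)

lemma key_in_keys:
  assumes "h \<in> H" "low j h t"
  shows "key h t \<in> keys j"
proof -
  have t: "t \<le> last_alive h" "length (hist (left_letter h t)) \<le> j" "length (hist (right_letter h t)) \<le> j"
    using assms(2) by (auto simp: low_def)
  note sp = split_run[OF assms(1) t(1)] and st = state_run[OF assms(1) run_le[OF assms(1) t(1)]]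
  have "orig (left_letter h t) < l" using sp(2) u(3) by (simp add: c1_def)
  moreover have "kind (left_letter h t) \<in> traced_kinds j" by (rule kind_mem[OF st sp(5) t(2)])
  moreover have "kind (right_letter h t) \<in> traced_kinds j" by (rule kind_mem[OF st sp(6) t(3)])
  ultimately show ?thesis by (simp add: key_def keys_def)
qed

lemma eta_eq:
  assumes "h \<in> H" "t \<le> last_alive h" "\<not> start_time h t"
  shows "eta h t = g \<otimes> (h \<otimes> pre ubar (orig (right_letter h t) - c2 h))"
  unfolding eta_def
  using split_run(4)[OF assms(1,2)] assms(3) by (intro pre_word_ubar[OF assms(1)]) (auto simp: start_time_def)

text \<open>The value before the left letter is a prefix of \<open>u\<close> and hence the same for all \<open>h\<close>; the gap
between the two letters is the same by \<open>slices_equal\<close>.\<close>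

lemma key_determines_eta:
  assumes "h1 \<in> H" "low j h1 t1" "h2 \<in> H" "low j h2 t2" "key h1 t1 = key h2 t2"
  shows "eta h1 t1 = eta h2 t2"
proof -
  have t: "t1 \<le> last_alive h1" "t2 \<le> last_alive h2" using assms by (auto simp: low_def)
  note s1 = split_run[OF assms(1) t(1)] and s2 = split_run[OF assms(3) t(2)]
  note st1 = state_run[OF assms(1) run_le[OF assms(1) t(1)]]
  note st2 = state_run[OF assms(3) run_le[OF assms(3) t(2)]]
  have ord: "orig (left_letter h1 t1) < orig (right_letter h1 t1)" "orig (left_letter h2 t2) < orig (right_letter h2 t2)"
    using s1 s2 by auto
  have same: "orig (left_letter h1 t1) = orig (left_letter h2 t2)" "letter (left_letter h1 t1) = letter (left_letter h2 t2)"
    "hist (left_letter h1 t1) = hist (left_letter h2 t2)" "letter (right_letter h1 t1) = letter (right_letter h2 t2)"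
    "hist (right_letter h1 t1) = hist (right_letter h2 t2)"
    using assms(5) by (auto simp: key_def kind_def)
  have S1: "state (word h1) (butlast (below c1 (Z h1 t1)) @ left_letter h1 t1 # [] @ right_letter h1 t1 # tl (above c1 (Z h1 t1)))"
    using st1 s1(1) by simp
  have S2: "state (word h2) (butlast (below c1 (Z h2 t2)) @ left_letter h2 t2 # [] @ right_letter h2 t2 # tl (above c1 (Z h2 t2)))"
    using st2 s2(1) by simp
  have "val (drop (orig (left_letter h1 t1)) (take (orig (right_letter h1 t1)) (word h1)))
      = val (drop (orig (left_letter h2 t2)) (take (orig (right_letter h2 t2)) (word h2)))"
    by (rule slices_equal[OF S1 S2 same(2-5) refl ord])
  moreover have "pre (word h1) (orig (left_letter h1 t1)) = pre (word h2) (orig (left_letter h2 t2))"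
    using s1(2) same(1) by (simp add: pre_word_u)
  ultimately show ?thesis
    unfolding eta_def
    using pre_slice[OF word_lists[OF assms(1)] less_imp_le[OF ord(1)]]
      pre_slice[OF word_lists[OF assms(3)] less_imp_le[OF ord(2)]] by simp
qed

lemma slots_subset: "slots j q \<subseteq> {..<length ubar}"
proof
  fix i assume "i \<in> slots j q"
  then obtain h t where "h \<in> H" "low j h t" "i = orig (right_letter h t) - c2 h"
    unfolding slots_def by blast
  then show "i \<in> {..<length ubar}"
    using split_run(4)[of h t] ubar(2) by (auto simp: low_def c3_def start_time_def)
qed

text \<open>Given the key and the position in \<open>ubar\<close>, the equation \<open>\<eta> = g h p\<close> determines \<open>h\<close>.\<close>

lemma card_visitors_le_slots: "card (visitors j q) \<le> card (slots j q)"
proof (rule card_le_of_functional(2))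
  define rel where "rel = (\<lambda>i h. \<exists>t. h \<in> H \<and> low j h t \<and> key h t = q \<and> i = orig (right_letter h t) - c2 h)"
  show "finite (slots j q)" using slots_subset finite_subset by blast
  show "\<exists>i\<in>slots j q. rel i h" if "h \<in> visitors j q" for h
    using that unfolding visitors_def slots_def rel_def by blast
  show "h = h'" if rels: "rel i h" "rel i h'" for i h h'
  proof -
    obtain t t' where t: "h \<in> H" "low j h t" "key h t = q" "i = orig (right_letter h t) - c2 h"
      and t': "h' \<in> H" "low j h' t'" "key h' t' = q" "i = orig (right_letter h' t') - c2 h'"
      using rels unfolding rel_def by blast
    have "eta h t = eta h' t'"
      by (rule key_determines_eta[OF t(1,2) t'(1,2)]) (simp add: t t')
    then have "g \<otimes> (h \<otimes> pre ubar i) = g \<otimes> (h' \<otimes> pre ubar i)"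
      using eta_eq[OF t(1), of t] eta_eq[OF t'(1), of t'] t t' by (simp add: low_def)
    then show ?thesis using g ubar(1) hH[OF t(1)] hH[OF t'(1)] by simp
  qed
qed

text \<open>With a common position, both values of \<open>\<eta>\<close> are of the form \<open>g h p = h g p\<close> with the same
\<open>p\<close>, and so both are linked to \<open>g p\<close>.\<close>

lemma slot_near:
  assumes "h1 \<in> H" "low j h1 t1" "h2 \<in> H" "low j h2 t2"
    and "slots j (key h1 t1) \<inter> slots j (key h2 t2) \<noteq> {}"
  shows "near pieces 2 (eta h1 t1) (eta h2 t2)"
proof -
  obtain i where "i \<in> slots j (key h1 t1)" "i \<in> slots j (key h2 t2)" using assms(5) by blast
  then obtain a s b t where a: "a \<in> H" "low j a s" "key a s = key h1 t1" "i = orig (right_letter a s) - c2 a"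
    and b: "b \<in> H" "low j b t" "key b t = key h2 t2" "i = orig (right_letter b t) - c2 b"
    unfolding slots_def by blast
  let ?p = "g \<otimes> pre ubar i"
  have p: "?p \<in> carrier G" using g ubar(1) by simp
  have e: "eta c r = c \<otimes> ?p" if "c \<in> H" "low j c r" "i = orig (right_letter c r) - c2 c" for c r
  proof -
    have "eta c r = g \<otimes> (c \<otimes> pre ubar i)" using eta_eq[of c r] that by (simp add: low_def)
    also have "\<dots> = (g \<otimes> c) \<otimes> pre ubar i" using g hH[OF that(1)] ubar(1) by (simp add: m_assoc)
    also have "\<dots> = c \<otimes> ?p" using g hH[OF that(1)] ubar(1) commute[OF that(1)] by (simp add: m_assoc)
    finally show ?thesis .
  qed
  have "eta h1 t1 = a \<otimes> ?p"
    using key_determines_eta[OF assms(1,2) a(1,2) a(3)[symmetric]] e[OF a(1,2,4)] by simp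
  then have 1: "link pieces ?p (eta h1 t1)" using link_v(3)[OF a(1) p] by simp
  have "eta h2 t2 = b \<otimes> ?p"
    using key_determines_eta[OF assms(3,4) b(1,2) b(3)[symmetric]] e[OF b(1,2,4)] by simp
  then have 2: "link pieces ?p (eta h2 t2)" using link_v(3)[OF b(1) p] by simp
  from near_trans[OF near1[OF link_sym[OF 1]] near1[OF 2]] show ?thesis by (simp only: one_add_one)
qed

definition poor where "poor j m h = {q \<in> keys j. h \<in> visitors j q \<and> card (visitors j q) < m}"

text \<open>Summing over \<open>H\<close>, each poor key is counted fewer than \<open>m\<close> times; an element with the smallest
share is at most average.\<close>

lemma few_poor:
  assumes "H \<noteq> {}"
  obtains h where "h \<in> H" "card H * card (poor j m h) \<le> l * (kind_bound j * kind_bound j) * m"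
proof -
  let ?K = "{q \<in> keys j. card (visitors j q) < m}"
  have fK: "finite ?K" using finite_keys(1)[of j] by simp
  have "(\<Sum>h\<in>H. card (poor j m h)) = (\<Sum>h\<in>H. \<Sum>q\<in>?K. of_bool (h \<in> visitors j q))"
  proof (rule sum.cong[OF refl])
    fix h
    have "poor j m h = {q \<in> ?K. h \<in> visitors j q}" by (auto simp: poor_def)
    then show "card (poor j m h) = (\<Sum>q\<in>?K. of_bool (h \<in> visitors j q))"
      using fK by (simp add: sum_of_bool_eq Int_def conj_ac)
  qed
  also have "\<dots> = (\<Sum>q\<in>?K. \<Sum>h\<in>H. of_bool (h \<in> visitors j q))" by (rule sum.swap)
  also have "\<dots> = (\<Sum>q\<in>?K. card (visitors j q))"
  proof (rule sum.cong[OF refl])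
    fix q
    have "visitors j q = {h \<in> H. h \<in> visitors j q}" by (auto simp: visitors_def)
    then have "card (visitors j q) = card {h \<in> H. h \<in> visitors j q}" by simp
    then show "(\<Sum>h\<in>H. of_bool (h \<in> visitors j q)) = card (visitors j q)"
      using H(1) by (simp add: sum_of_bool_eq Int_def)
  qed
  also have "\<dots> \<le> card ?K * m"
    using sum_bounded_above[of ?K "\<lambda>q. card (visitors j q)" m] by simp
  also have "\<dots> \<le> card (keys j) * m"
    using finite_keys(1) by (intro mult_le_mono card_mono) auto
  also have "\<dots> \<le> l * (kind_bound j * kind_bound j) * m"
    using finite_keys(2) by (intro mult_le_mono) auto
  finally have total: "(\<Sum>h\<in>H. card (poor j m h)) \<le> l * (kind_bound j * kind_bound j) * m" .
  define h where "h = (ARG_MIN (\<lambda>h. card (poor j m h)) h. h \<in> H)"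
  have h: "h \<in> H" "\<And>h'. h' \<in> H \<Longrightarrow> card (poor j m h) \<le> card (poor j m h')"
    unfolding h_def using assms by (auto intro: arg_min_natI arg_min_nat_le)
  have "card H * card (poor j m h) \<le> (\<Sum>h\<in>H. card (poor j m h))"
    using sum_bounded_below[of H "card (poor j m h)" "\<lambda>h. card (poor j m h)"] h(2) by simp
  then show thesis using that[OF h(1)] total by linarith
qed

text \<open>Two times of the same colour are within distance 6, the worst case being that of rich keys: one
link from \<open>\<xi>\<close> to \<open>\<eta>\<close> on either side, and two links each from these to the value of \<open>\<eta>\<close> at
the common centre. With one more link for the step to the next colour this gives the factor 7.
The constant 16 collects the colour \<open>Start\<close> and the two ends of the walk.\<close>

lemma close_to_identity:
  assumes "H \<noteq> {}" "m > 0"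
  obtains N where "near pieces N \<one> g"
    "real N \<le> 16 + 14 * ((V / Suc V) ^ j * (Suc V * (4 * l)))
        + 7 * (l * (kind_bound j * kind_bound j) * m / card H) + 7 * (l / m)"
proof -
  obtain h where h: "h \<in> H" "card H * card (poor j m h) \<le> l * (kind_bound j * kind_bound j) * m"
    using few_poor[OF assms(1)] .
  let ?rich = "{q. m \<le> card (visitors j q)} \<inter> keys j"
  have fr: "finite ?rich" using finite_keys(1) by blast
  have "slots j q \<subseteq> {..<length ubar} \<and> m \<le> card (slots j q)" if "q \<in> ?rich" for q
    using that slots_subset card_visitors_le_slots[of j q] by auto
  note centres = disjoint_centres[of ?rich "slots j", OF fr this assms(2)]
  obtain C where C: "C \<subseteq> ?rich" "card C * m \<le> length ubar"
    "\<forall>q\<in>?rich. \<exists>c\<in>C. slots j q \<inter> slots j c \<noteq> {}"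
    by (rule centres)
  define centre where "centre q = (SOME c. c \<in> C \<and> slots j q \<inter> slots j c \<noteq> {})" for q
  have centre: "centre q \<in> C" "slots j q \<inter> slots j (centre q) \<noteq> {}" if "q \<in> ?rich" for q
  proof -
    have "\<exists>c. c \<in> C \<and> slots j q \<inter> slots j c \<noteq> {}" using bspec[OF C(3) that] by (elim bexE) blast
    note c = someI_ex[OF this, folded centre_def]
    show "centre q \<in> C" by (rule conjunct1[OF c])
    show "slots j q \<inter> slots j (centre q) \<noteq> {}" by (rule conjunct2[OF c])
  qed
  define old where "old = {x. \<exists>t\<le>len h. x \<in> set (Z h t) \<and> j \<le> length (hist x)}"
  define col where "col t =
    (if start_time h t then Start
     else if j \<le> length (hist (left_letter h t)) then Old_left (left_letter h t)
     else if j \<le> length (hist (right_letter h t)) then Old_right (right_letter h t)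
     else if card (visitors j (key h t)) < m then Poor (key h t)
     else Rich (centre (key h t)))" for t
  define cols where "cols = insert Start (Old_left ` old \<union> Old_right ` old \<union> Poor ` poor j m h \<union> Rich ` C)"
  have fin: "finite old" "finite (poor j m h)" "finite C"
    using old_letters(1)[OF h(1), of j] finite_keys(1)[of j] finite_subset[OF C(1) fr]
    by (auto simp: old_def poor_def)
  have vis: "low j h t \<Longrightarrow> h \<in> visitors j (key h t)" for t
    using h(1) by (auto simp: visitors_def)
  have colours: "xi h t \<in> carrier G \<and> col t \<in> cols" if "t \<le> last_alive h" for t
  proof -
    note sp = split_run[OF h(1) that] and le = run_le[OF h(1) that]
    have "col t \<in> cols"
    proof -
      consider "start_time h t" | "\<not> start_time h t" "j \<le> length (hist (left_letter h t))"
        | "\<not> start_time h t" "\<not> j \<le> length (hist (left_letter h t))" "j \<le> length (hist (right_letter h t))"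
        | "\<not> start_time h t" "\<not> j \<le> length (hist (left_letter h t))" "\<not> j \<le> length (hist (right_letter h t))" by blast
      then show ?thesis
      proof cases
        case 4
        then have low: "low j h t" using that by (simp add: low_def)
        note k = key_in_keys[OF h(1) low]
        show ?thesis
        proof (cases "card (visitors j (key h t)) < m")
          case True
          then have "key h t \<in> poor j m h" using k vis[OF low] by (simp add: poor_def)
          then show ?thesis using 4 True by (simp add: col_def cols_def)
        next
          case False
          then have "centre (key h t) \<in> C" using centre(1)[of "key h t"] k by simp
          then show ?thesis using 4 False by (simp add: col_def cols_def)
        qed
      qed (use le sp(5,6) in \<open>auto simp: col_def cols_def old_def\<close>)
    qed
    then show ?thesis using xi_closed[OF h(1)] by blast
  qed
  have xe: "near pieces 1 (xi h t) (eta h t)" if "t \<le> last_alive h" for t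
    unfolding eta_def by (rule near1[OF link_xy[OF h(1) that]])
  have same: "near pieces 6 (xi h s) (xi h t)" if st: "s \<le> last_alive h" "t \<le> last_alive h" "col s = col t" for s t
  proof -
    note cx = xi_closed[OF h(1)]
    consider (start) "start_time h s" "start_time h t"
      | (left) "left_letter h s = left_letter h t"
      | (right) "\<not> start_time h s" "\<not> start_time h t" "right_letter h s = right_letter h t"
      | (poor) "key h s = key h t"
      | (rich) "low j h s" "low j h t" "\<not> card (visitors j (key h s)) < m"
          "\<not> card (visitors j (key h t)) < m" "centre (key h s) = centre (key h t)"
      using st by (fastforce simp: col_def low_def split: if_splits)
    then show ?thesis
    proof cases
      case start
      from near_trans[OF start_time_near[OF h(1) st(1) start(1)] near_sym[OF start_time_near[OF h(1) st(2) start(2)]]]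
      show ?thesis by (rule near_mono) (use cx in auto)
    next
      case left
      then show ?thesis using near_refl[OF cx] by (simp add: xi_def)
    next
      case right
      have e: "eta h s = eta h t" using right by (simp add: eta_def)
      from near_trans[OF xe[OF st(1), unfolded e] near_sym[OF xe[OF st(2)]]]
      show ?thesis by (rule near_mono) (use cx in auto)
    next
      case poor
      then have "orig (left_letter h s) = orig (left_letter h t)" by (simp add: key_def)
      then show ?thesis using near_refl[OF cx] by (simp add: xi_def)
    next
      case rich
      have k: "key h s \<in> ?rich" "key h t \<in> ?rich"
        using rich key_in_keys[OF h(1)] by auto
      let ?c = "centre (key h s)"
      have "visitors j ?c \<noteq> {}"
        using centre(1)[OF k(1)] C(1) assms(2) by force
      then obtain h' t' where c: "h' \<in> H" "low j h' t'" "key h' t' = ?c"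
        unfolding visitors_def by blast
      have 1: "near pieces 2 (eta h s) (eta h' t')"
        by (rule slot_near[OF h(1) rich(1) c(1,2)]) (use centre(2)[OF k(1)] c(3) in simp)
      have 2: "near pieces 2 (eta h t) (eta h' t')"
        by (rule slot_near[OF h(1) rich(2) c(1,2)]) (use centre(2)[OF k(2)] c(3) rich(5) in simp)
      from near_trans[OF near_trans[OF xe[OF st(1)] 1] near_sym[OF near_trans[OF xe[OF st(2)] 2]]]
      show ?thesis by (rule near_mono) (use cx in auto)
    qed
  qed
  have fc: "finite cols" using fin by (simp add: cols_def)
  have "near pieces ((1 + 6) * card cols) (xi h 0) (xi h (last_alive h))"
    by (rule near_along_colours[OF fc]) (use colours same xi_step[OF h(1)] in auto)
  from near_trans[OF near_trans[OF near_sym[OF start_time_near[OF h(1) _ start_time_0[OF h(1)]]] this] xi_end[OF h(1)]]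
  have path: "near pieces (2 + (1 + 6) * card cols + 7) g \<one>" by simp
  have "card cols \<le> 1 + (card old + card old + card (poor j m h) + card C)"
  proof -
    have "card cols \<le> Suc (card (Old_left ` old \<union> Old_right ` old \<union> Poor ` poor j m h \<union> Rich ` C))"
      unfolding cols_def by (rule card_insert_le_m1) auto
    also have "card (Old_left ` old \<union> Old_right ` old \<union> Poor ` poor j m h \<union> Rich ` C)
       \<le> card old + card old + card (poor j m h) + card C"
      by (intro order_trans[OF card_Un_le] add_mono card_image_le fin)
    finally show ?thesis by simp
  qed
  moreover have "real (card old) \<le> (V / Suc V) ^ j * (Suc V * (4 * l))"
    unfolding old_def by (rule old_letters(2)[OF h(1)])
  moreover have "real (card (poor j m h)) \<le> l * (kind_bound j * kind_bound j) * m / card H"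
  proof -
    have "card H > 0" using assms(1) H(1) by auto
    moreover have "real (card H) * real (card (poor j m h)) \<le> real (l * (kind_bound j * kind_bound j) * m)"
      using h(2) by (metis of_nat_le_iff of_nat_mult)
    ultimately show ?thesis by (simp add: field_simps)
  qed
  moreover have "real (card C) \<le> l / m"
  proof -
    have "card C * m \<le> l" using C(2) ubar(3) by linarith
    then have "real (card C) * real m \<le> real l" by (metis of_nat_le_iff of_nat_mult)
    then show ?thesis using assms(2) by (simp add: field_simps)
  qed
  ultimately have "real (2 + (1 + 6) * card cols + 7) \<le>
      16 + 14 * ((V / Suc V) ^ j * (Suc V * (4 * l)))
        + 7 * (l * (kind_bound j * kind_bound j) * m / card H) + 7 * (l / m)"
    by simp
  then show thesis using that near_sym[OF path] by blast
qed

end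

section \<open>The number of elements reached by short chains\<close>

context cannon_group
begin

definition representable :: "nat \<Rightarrow> 'a \<Rightarrow> bool" where
  "representable l g \<longleftrightarrow> (\<exists>w \<in> lists X. w \<noteq> [] \<and> length w \<le> l \<and> val w = g)"

lemma card_le_power_of_near:
  assumes S: "S \<subseteq> carrier G" "S \<noteq> {}" and H: "finite H" "H \<noteq> {}" "H \<subseteq> carrier G"
    and rep: "\<And>g. g \<in> S \<union> H \<Longrightarrow> representable l g \<and> representable l (inv g)"
    and commute: "\<And>g h. g \<in> S \<Longrightarrow> h \<in> H \<Longrightarrow> g \<otimes> h = h \<otimes> g"
    and young: "(V / Suc V) ^ k * (Suc V * (4 * l)) < (1 :: real)" and m: "m > 0"
    and N: "16 + 14 * ((V / Suc V) ^ j * (Suc V * (4 * l)))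
        + 7 * (l * (kind_bound j * kind_bound j) * m / card H) + 7 * (l / m) \<le> real N"
  shows "finite S" "card S \<le> Suc (4 * (Suc (kind_bound k * kind_bound k * Suc (card A) ^ Suc V)
     + 2 * (kind_bound k * Suc (card A) ^ Suc V) + 2 * (card H * Suc l))) ^ N"
proof -
  define b where "b = Suc (kind_bound k * kind_bound k * Suc (card A) ^ Suc V)
     + 2 * (kind_bound k * Suc (card A) ^ Suc V) + 2 * (card H * Suc l)"
  obtain v where v: "\<And>h. h \<in> H \<Longrightarrow> v h \<in> lists X \<and> v h \<noteq> [] \<and> length (v h) \<le> l \<and> val (v h) = h"
    using rep unfolding representable_def by (metis UnCI)
  obtain vbar where vbar: "\<And>h. h \<in> H \<Longrightarrow> vbar h \<in> lists X \<and> length (vbar h) \<le> l \<and> val (vbar h) = inv h"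
    using rep unfolding representable_def by (metis UnCI)
  define Q where "Q = gaps k \<union> ends k \<union> (\<lambda>(h, i). pre (v h) i) ` (H \<times> {..l}) \<union> (\<lambda>(h, i). pre (vbar h) i) ` (H \<times> {..l})"
  have each: "finite Q \<and> card Q \<le> b \<and> Q \<subseteq> carrier G \<and> near Q N \<one> g" if g: "g \<in> S" for g
  proof -
    obtain u where u: "u \<in> lists X" "u \<noteq> []" "length u \<le> l" "val u = g"
      using rep[of g] g unfolding representable_def by blast
    obtain ubar where ubar: "ubar \<in> lists X" "ubar \<noteq> []" "length ubar \<le> l" "val ubar = inv g"
      using rep[of g] g unfolding representable_def by blast
    interpret c: commutator_words G X A R ev V g u ubar H v vbar l k
      using g S H u ubar v vbar commute young by unfold_locales auto
    have Q: "c.pieces = Q" by (simp add: c.pieces_def Q_def)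
    have "\<exists>Z n. Z 0 = start (c.word h) \<and> Z n = [] \<and> (\<forall>t<n. tstep R (Z t) (Z (Suc t)))" if "h \<in> H" for h
    proof -
      have "(nca_step R)\<^sup>*\<^sup>* (c.word h) []"
        using solves_word_problem[OF c.word_lists[OF that]] c.val_word[OF that] by (simp add: val_def)
      from traced_run[OF this] show ?thesis by metis
    qed
    then obtain Z n where Z: "\<And>h. h \<in> H \<Longrightarrow> Z h 0 = start (c.word h) \<and> Z h (n h) = [] \<and>
        (\<forall>t<n h. tstep R (Z h t) (Z h (Suc t)))"
      by metis
    interpret r: commutator_runs G X A R ev V g u ubar H v vbar l k Z n
      using Z by unfold_locales auto
    obtain N' where N': "near Q N' \<one> g" "real N' \<le> 16 + 14 * ((V / Suc V) ^ j * (Suc V * (4 * l)))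
        + 7 * (l * (kind_bound j * kind_bound j) * m / card H) + 7 * (l / m)"
      using r.close_to_identity[OF H(2) m, of j] unfolding Q by blast
    then have "N' \<le> N" using N by linarith
    then have "near Q N \<one> g" by (rule near_mono[OF N'(1)]) simp
    then show ?thesis using c.finite_pieces c.card_pieces c.pieces_closed unfolding Q b_def by blast
  qed
  have Q: "finite Q" "card Q \<le> b" "Q \<subseteq> carrier G" using each S(2) by blast+
  have sub: "S \<subseteq> {y. near Q N \<one> y}" using each by blast
  note c = card_near[OF Q(1,3) one_closed, of N]
  show "finite S" using sub c finite_subset by blast
  have "card S \<le> Suc (4 * card Q) ^ N" using card_mono[OF _ sub] c by (meson le_trans)
  also have "\<dots> \<le> Suc (4 * b) ^ N" using Q(2) by (intro power_mono) auto
  finally show "card S \<le> Suc (4 * (Suc (kind_bound k * kind_bound k * Suc (card A) ^ Suc V)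
     + 2 * (kind_bound k * Suc (card A) ^ Suc V) + 2 * (card H * Suc l))) ^ N" unfolding b_def .
qed

text \<open>All quantities are exponential in \<open>j\<close>. The base \<open>D\<close> exceeds the square of the number of
possible extensions of a history, so that there are at most about \<open>D\<^sup>j\<close> pairs of short
histories. With \<open>n = D\<^sup>4\<^sup>j\<close> and threshold \<open>m = D\<^sup>2\<^sup>j\<close>, up to constant factors poor keys
contribute \<open>D\<^sup>3\<^sup>j\<close> colours, rich ones \<open>D\<^sup>2\<^sup>j\<close>, and letters with long
histories a share of \<open>n\<close> that decays geometrically; all three are dominated by \<open>r\<^sup>j n\<close>. The size of \<open>H\<close> is bounded from above as well, since \<open>H\<close> enters
the set of pieces.\<close>

lemma log_card_bound:
  fixes C :: nat and a2 :: real
  assumes C: "C \<ge> 1" and a2: "a2 > 0"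
  obtains c r E :: real and D :: nat where "0 \<le> c" "0 \<le> r" "r < 1" "1 \<le> E" "2 \<le> D"
    "\<forall>j S H. S \<subseteq> carrier G \<and> S \<noteq> {} \<and> finite H \<and> H \<noteq> {} \<and> H \<subseteq> carrier G \<and>
      (\<forall>g \<in> S \<union> H. representable (C * D ^ (4 * j)) g \<and> representable (C * D ^ (4 * j)) (inv g)) \<and>
      (\<forall>g \<in> S. \<forall>h \<in> H. g \<otimes> h = h \<otimes> g) \<and>
      a2 * D ^ (4 * j) \<le> card H \<and> card H \<le> a2 * D ^ (4 * j) + 1 \<longrightarrow>
      ln (card S) \<le> c * r ^ j * D ^ (4 * j) * (real j + 1) * ln E"
proof -
  define lam where "lam = V / Suc V"
  define \<beta> where "\<beta> = Suc (card (trace_marks (Suc V)))"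
  define a where "a = card A"
  define s where "s = Suc a ^ Suc V"
  \<comment> \<open>One more than \<open>\<beta>\<close>, so that \<open>D\<close> is at least 2 even when there are no rules.\<close>
  define D where "D = (\<beta> + 1)\<^sup>2"
  define r where "r = max lam (1 / D)"
  have lam: "0 \<le> lam" "lam < 1" by (auto simp: lam_def)
  have "\<beta> \<ge> 1" by (simp add: \<beta>_def)
  then have "2 ^ 2 \<le> D" unfolding D_def by (intro power_mono) auto
  then have D2: "2 \<le> D" by simp
  have r: "0 \<le> r" "r < 1" using lam D2 by (auto simp: r_def)
  have "0 < 1 / real D ^ 4" using D2 by simp
  then obtain J where J: "lam ^ J < 1 / real D ^ 4" using real_arch_pow_inv lam(2) by blast
  have "0 < 1 / (real (Suc V) * 4 * C)" using C by simp
  then obtain J0 where J0: "lam ^ J0 < 1 / (real (Suc V) * 4 * C)" using real_arch_pow_inv lam(2) by blast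
  define c where "c = 17 + 56 * real (Suc V) * real C + 7 * real C * (real a)\<^sup>2 / a2 + 7 * real C"
  define M where "M = 5 + 4 * (real a)\<^sup>2 * real \<beta> ^ (2 * J0) * real s + 8 * real a * real \<beta> ^ (2 * J0) * real s + 8 * (a2 + 1) * (real C + 1)"
  define B where "B = real (\<beta> ^ (2 * J) * D ^ 8)"
  define E where "E = M * B"
  have "1 \<le> \<beta> ^ (2 * J) * D ^ 8" using \<open>\<beta> \<ge> 1\<close> D2 by simp
  then have B: "1 \<le> B" unfolding B_def by (metis of_nat_1 of_nat_le_iff)
  have "0 \<le> 8 * (a2 + 1) * (real C + 1)" using a2 by simp
  moreover have "0 \<le> 4 * (real a)\<^sup>2 * real \<beta> ^ (2 * J0) * real s" "0 \<le> 8 * real a * real \<beta> ^ (2 * J0) * real s"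
    by simp_all
  ultimately have M: "1 \<le> M" unfolding M_def by linarith
  have E: "1 \<le> E" unfolding E_def using M B mult_mono[of 1 M 1 B] by simp
  have c0: "0 \<le> c" using a2 by (simp add: c_def)
  have main: "ln (card S) \<le> c * r ^ j * D ^ (4 * j) * (real j + 1) * ln E"
    if S: "S \<subseteq> carrier G" "S \<noteq> {}" and H: "finite H" "H \<noteq> {}" "H \<subseteq> carrier G"
      and rep: "\<And>g. g \<in> S \<union> H \<Longrightarrow> representable (C * D ^ (4 * j)) g \<and> representable (C * D ^ (4 * j)) (inv g)"
      and comm: "\<And>g h. g \<in> S \<Longrightarrow> h \<in> H \<Longrightarrow> g \<otimes> h = h \<otimes> g"
      and cH: "a2 * D ^ (4 * j) \<le> card H" "card H \<le> a2 * D ^ (4 * j) + 1" for j S H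
  proof -
    define n where "n = D ^ (4 * j)"
    define l where "l = C * n"
    \<comment> \<open>Chosen so that the decay of the number of letters with histories of length \<open>k\<close> outweighs
  \<open>D\<^sup>4\<^sup>j\<close>.\<close>
    define k where "k = J * j + J0"
    define m where "m = D ^ (2 * j)"
    have n1: "1 \<le> real n" using D2 by (simp add: n_def)
    have m0: "m > 0" using D2 by (simp add: m_def)
    have nr: "real D ^ (3 * j) \<le> r ^ j * n" "lam ^ j * n \<le> r ^ j * n" "real n / m \<le> r ^ j * n" "1 \<le> r ^ j * n"
    proof -
      have "(1 / real D) ^ j \<le> r ^ j" using D2 by (intro power_mono) (auto simp: r_def)
      then have *: "(1 / real D) ^ j * n \<le> r ^ j * n" by (intro mult_right_mono) auto
      have "real D ^ (4 * j) = real D ^ j * real D ^ (3 * j)" by (simp flip: power_add)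
      then have "(1 / real D) ^ j * n = real D ^ (3 * j)"
        using D2 by (simp add: n_def power_one_over field_simps)
      then show 3: "real D ^ (3 * j) \<le> r ^ j * n" using * by simp
      show "lam ^ j * n \<le> r ^ j * n"
        using lam by (intro mult_right_mono power_mono) (auto simp: r_def)
      have "real D ^ (4 * j) = real D ^ (2 * j) * real D ^ (2 * j)" by (simp flip: power_add)
      then have "real n / m = real D ^ (2 * j)" using D2 by (simp add: n_def m_def)
      also have "\<dots> \<le> real D ^ (3 * j)" using D2 by (intro power_increasing) auto
      finally show "real n / m \<le> r ^ j * n" using 3 by simp
      have "1 \<le> real D ^ (3 * j)" using D2 by (intro one_le_power) auto
      then show "1 \<le> r ^ j * n" using 3 by linarith
    qed
    have young: "(V / Suc V) ^ k * (Suc V * (4 * l)) < (1 :: real)"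
    proof -
      have "lam ^ J * real D ^ 4 \<le> 1" using J D2 by (simp add: pos_less_divide_eq less_imp_le)
      then have 1: "(lam ^ J * real D ^ 4) ^ j \<le> 1" using lam by (intro power_le_one) auto
      have 2: "lam ^ J0 * (real (Suc V) * 4 * C) < 1"
        using J0 pos_less_divide_eq[of "real (Suc V) * 4 * C" "lam ^ J0" 1] C by simp
      have 3: "0 \<le> lam ^ J0 * (real (Suc V) * 4 * C)" using lam by simp
      have "lam ^ k * (Suc V * (4 * l)) = (lam ^ J * real D ^ 4) ^ j * (lam ^ J0 * (real (Suc V) * 4 * C))"
      proof -
        have "real n = (real D ^ 4) ^ j" by (simp add: n_def power_mult)
        then have "real (Suc V * (4 * l)) = (real (Suc V) * 4 * C) * (real D ^ 4) ^ j"
          by (simp only: l_def of_nat_mult of_nat_numeral mult.assoc)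
        moreover have "lam ^ k = (lam ^ J) ^ j * lam ^ J0" by (simp add: k_def power_add power_mult)
        ultimately show ?thesis by (simp only: power_mult_distrib mult_ac)
      qed
      also have "\<dots> \<le> 1 * (lam ^ J0 * (real (Suc V) * 4 * C))" by (rule mult_right_mono[OF 1 3])
      finally show ?thesis using 2 by (simp add: lam_def)
    qed
    define K where "K = 16 + 14 * ((V / Suc V) ^ j * (Suc V * (4 * l)))
        + 7 * (l * (kind_bound j * kind_bound j) * m / card H) + 7 * (l / m)"
    define N where "N = nat \<lceil>K\<rceil>"
    have KN: "K \<le> real N" by (simp add: N_def real_nat_ceiling_ge)
    have K: "K + 1 \<le> c * (r ^ j * n)"
    proof -
      have 1: "17 \<le> 17 * (r ^ j * n)" using nr(4) by simp
      have "14 * ((V / Suc V) ^ j * (Suc V * (4 * l))) = (56 * real (Suc V) * real C) * (lam ^ j * n)"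
        unfolding lam_def[symmetric] l_def by (simp add: algebra_simps)
      also have "\<dots> \<le> (56 * real (Suc V) * real C) * (r ^ j * n)" using nr(2) by (intro mult_left_mono) auto
      finally have 2: "14 * ((V / Suc V) ^ j * (Suc V * (4 * l))) \<le> (56 * real (Suc V) * real C) * (r ^ j * n)" .
      have "kind_bound j * kind_bound j = a\<^sup>2 * (\<beta>\<^sup>2) ^ j"
        unfolding kind_bound_def a_def[symmetric] \<beta>_def[symmetric]
        by (simp add: power2_eq_square power_mult_distrib)
      also have "\<dots> \<le> a\<^sup>2 * D ^ j"
        unfolding D_def by (intro mult_le_mono power_mono order_refl) auto
      finally have kb: "kind_bound j * kind_bound j \<le> a\<^sup>2 * D ^ j" .
      have "l * (kind_bound j * kind_bound j) * m \<le> l * (a\<^sup>2 * D ^ j) * m"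
        by (rule mult_le_mono1[OF mult_le_mono2[OF kb]])
      also have "\<dots> = C * a\<^sup>2 * D ^ (3 * j) * n"
        by (simp add: l_def m_def flip: power_add)
      finally have "real (l * (kind_bound j * kind_bound j) * m) \<le> real C * (real a)\<^sup>2 * real D ^ (3 * j) * n"
        by (metis of_nat_le_iff of_nat_mult of_nat_power)
      note lm = this
      have "real (l * (kind_bound j * kind_bound j) * m) / card H \<le> real C * (real a)\<^sup>2 * real D ^ (3 * j) * n / (a2 * n)"
      proof (rule frac_le)
        show "0 < a2 * real n" using a2 n1 by (intro mult_pos_pos) linarith+
        show "a2 * real n \<le> real (card H)" using cH(1) by (simp add: n_def)
      qed (rule mult_nonneg_nonneg lm | simp)+
      also have "\<dots> = (real C * (real a)\<^sup>2 / a2) * real D ^ (3 * j)" using n1 by simp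
      also have "\<dots> \<le> (real C * (real a)\<^sup>2 / a2) * (r ^ j * n)"
        using nr(1) a2 by (intro mult_left_mono) auto
      finally have 3: "7 * (l * (kind_bound j * kind_bound j) * m / card H) \<le> (7 * real C * (real a)\<^sup>2 / a2) * (r ^ j * n)"
        by simp
      have "7 * (l / m) = (7 * real C) * (real n / m)" by (simp add: l_def)
      also have "\<dots> \<le> (7 * real C) * (r ^ j * n)" using nr(3) by (intro mult_left_mono) auto
      finally have 4: "7 * (l / m) \<le> (7 * real C) * (r ^ j * n)" .
      have "c * (r ^ j * n) = 17 * (r ^ j * n) + (56 * real (Suc V) * real C) * (r ^ j * n)
          + (7 * real C * (real a)\<^sup>2 / a2) * (r ^ j * n) + (7 * real C) * (r ^ j * n)"
        unfolding c_def by (simp only: distrib_right)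
      then show ?thesis using 1 2 3 4 unfolding K_def by linarith
    qed
    have "0 \<le> K" unfolding K_def by (intro add_nonneg_nonneg mult_nonneg_nonneg) auto
    then have "real N \<le> K + 1" unfolding N_def by linarith
    then have N: "real N \<le> c * (r ^ j * n)" using K by linarith
    define b where "b = Suc (4 * (Suc (kind_bound k * kind_bound k * Suc (card A) ^ Suc V)
     + 2 * (kind_bound k * Suc (card A) ^ Suc V) + 2 * (card H * Suc l)))"
    have fin: "finite S" and card: "card S \<le> b ^ N"
      using card_le_power_of_near[OF S H rep[folded n_def l_def] comm young m0 KN[unfolded K_def]]
      unfolding b_def by blast+
    have bE: "real b \<le> E ^ (j + 1)"
    proof -
      have Bj: "1 \<le> B ^ j" using B by (rule one_le_power)
      have kb: "real (kind_bound k) = a * real \<beta> ^ J0 * real \<beta> ^ (J * j)"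
        by (simp add: kind_bound_def a_def \<beta>_def k_def power_add)
      have \<beta>1: "1 \<le> real \<beta>" using \<open>\<beta> \<ge> 1\<close> by simp
      have BB: "real \<beta> ^ (2 * (J * j)) \<le> B ^ j" "real D ^ (8 * j) \<le> B ^ j"
      proof -
        have "B ^ j = real \<beta> ^ (2 * (J * j)) * real D ^ (8 * j)"
          by (simp add: B_def power_mult_distrib mult_ac flip: power_mult)
        moreover have "1 \<le> real \<beta> ^ (2 * (J * j))" "1 \<le> real D ^ (8 * j)"
          using \<beta>1 D2 by (auto intro!: one_le_power)
        ultimately show "real \<beta> ^ (2 * (J * j)) \<le> B ^ j" "real D ^ (8 * j) \<le> B ^ j"
          by (simp_all add: mult_le_cancel_left1 mult_le_cancel_right1)
      qed
      have "real (kind_bound k) * real (kind_bound k) = (real a)\<^sup>2 * real \<beta> ^ (2 * J0) * real \<beta> ^ (2 * (J * j))"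
        unfolding kb by (simp add: power2_eq_square mult_2 power_add)
      also have "\<dots> \<le> (real a)\<^sup>2 * real \<beta> ^ (2 * J0) * B ^ j"
        using BB by (intro mult_left_mono) auto
      finally have 1: "real (kind_bound k) * real (kind_bound k) * s \<le> (real a)\<^sup>2 * real \<beta> ^ (2 * J0) * B ^ j * s"
        by (intro mult_right_mono) auto
      have "real (kind_bound k) \<le> a * real \<beta> ^ (2 * J0) * real \<beta> ^ (2 * (J * j))"
      proof -
        have "i \<le> 2 * i" for i :: nat by simp
        note p = power_increasing[OF this \<beta>1]
        show ?thesis unfolding kb by (intro mult_mono p) auto
      qed
      also have "\<dots> \<le> a * real \<beta> ^ (2 * J0) * B ^ j" using BB by (intro mult_left_mono) auto
      finally have 2: "real (kind_bound k) * s \<le> a * real \<beta> ^ (2 * J0) * B ^ j * s"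
        by (intro mult_right_mono) auto
      have "real (card H) \<le> (a2 + 1) * n" using cH(2) n1 a2 by (simp add: n_def distrib_right)
      moreover have "real (Suc l) \<le> (real C + 1) * n" using n1 by (simp add: l_def distrib_right)
      ultimately have "real (card H) * real (Suc l) \<le> ((a2 + 1) * n) * ((real C + 1) * n)"
        using a2 by (intro mult_mono) auto
      also have "\<dots> = (a2 + 1) * (real C + 1) * real D ^ (8 * j)"
      proof -
        have "real n * real n = real D ^ (8 * j)" by (simp add: n_def flip: power_add)
        then show ?thesis by (simp add: algebra_simps)
      qed
      also have "\<dots> \<le> (a2 + 1) * (real C + 1) * B ^ j" using BB a2 by (intro mult_left_mono) auto
      finally have 3: "real (card H) * real (Suc l) \<le> (a2 + 1) * (real C + 1) * B ^ j" .
      have "real b = 5 + 4 * (real (kind_bound k) * real (kind_bound k) * s)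
          + 8 * (real (kind_bound k) * s) + 8 * (real (card H) * real (Suc l))"
        unfolding b_def s_def a_def by (simp add: algebra_simps)
      also have "\<dots> \<le> 5 * B ^ j + 4 * ((real a)\<^sup>2 * real \<beta> ^ (2 * J0) * B ^ j * s)
          + 8 * (a * real \<beta> ^ (2 * J0) * B ^ j * s) + 8 * ((a2 + 1) * (real C + 1) * B ^ j)"
        using 1 2 3 Bj by linarith
      also have "\<dots> = M * B ^ j" by (simp add: M_def algebra_simps)
      also have "\<dots> \<le> M ^ (j + 1) * B ^ (j + 1)"
      proof (intro mult_mono)
        show "M \<le> M ^ (j + 1)" using M self_le_power[of M "j + 1"] by simp
        show "B ^ j \<le> B ^ (j + 1)" using B by (intro power_increasing) auto
      qed (use M B in auto)
      also have "\<dots> = E ^ (j + 1)" unfolding E_def by (rule power_mult_distrib[symmetric])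
      finally show ?thesis .
    qed
    have b0: "0 < real b" unfolding b_def by (simp only: of_nat_0_less_iff zero_less_Suc)
    have "card S > 0" using fin S by (simp add: card_gt_0_iff)
    then have "ln (card S) \<le> ln (real (b ^ N))" using card by (intro ln_mono) auto
    also have "\<dots> = N * ln b" using b0 by (simp add: ln_realpow)
    also have "\<dots> \<le> N * ln (E ^ (j + 1))"
      using ln_mono[OF bE b0] by (intro mult_left_mono) auto
    also have "\<dots> = N * ((real j + 1) * ln E)" using E by (subst ln_realpow) auto
    also have "\<dots> \<le> c * (r ^ j * n) * ((real j + 1) * ln E)"
      using N E by (intro mult_right_mono) auto
    finally show ?thesis by (simp add: n_def mult_ac add.commute)
  qed
  show thesis
    by (rule that[OF c0 r E D2]) (intro allI impI, elim conjE, rule main; blast)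
qed

end

lemma subexponential_loses:
  fixes a0 a1 c r L :: real and D :: nat
  assumes "0 < a0" "1 < a1" "0 \<le> r" "r < 1" "2 \<le> D"
  shows "\<forall>\<^sub>F j in sequentially. c * r ^ j * D ^ (4 * j) * (real j + 1) * L < ln (a0 * a1 ^ (D ^ (4 * j)))"
proof -
  define q where "q = ln a1"
  have q: "0 < q" using assms by (simp add: q_def)
  have "(\<lambda>j. real j * r ^ j) \<longlonglongrightarrow> 0" using powser_times_n_limit_0[of r] assms by simp
  moreover have "(\<lambda>j. r ^ j) \<longlonglongrightarrow> 0" using assms by (intro LIMSEQ_power_zero) simp
  ultimately have "(\<lambda>j. c * L * (real j * r ^ j + r ^ j)) \<longlonglongrightarrow> c * L * (0 + 0)"
    by (intro tendsto_mult tendsto_const tendsto_add)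
  then have "(\<lambda>j. c * L * (real j * r ^ j + r ^ j)) \<longlonglongrightarrow> 0" by simp
  then have "\<forall>\<^sub>F j in sequentially. c * L * (real j * r ^ j + r ^ j) < q / 2"
    using q by (intro order_tendstoD) auto
  moreover have "\<forall>\<^sub>F j in sequentially. - ln a0 < real j * (q / 2)"
  proof -
    have "\<forall>\<^sub>F j in sequentially. - ln a0 / (q / 2) < real j" by (rule eventually_gt_at_top[THEN filterlim_real_sequentially[unfolded filterlim_iff, rule_format]])
    then show ?thesis using q by (simp add: field_simps)
  qed
  ultimately show ?thesis
  proof eventually_elim
    case (elim j)
    let ?n = "real (D ^ (4 * j))"
    have "j \<le> 4 * j" by simp
    also have "4 * j \<le> D ^ (4 * j)" using assms(5) by (intro less_imp_le_nat power_gt_expt) simp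
    finally have n: "real j \<le> ?n" by (metis of_nat_le_iff)
    have n1: "0 < ?n" using assms(5) by simp
    have "c * r ^ j * ?n * (real j + 1) * L = c * L * (real j * r ^ j + r ^ j) * ?n"
      by (simp add: algebra_simps)
    also have "\<dots> < q / 2 * ?n" using elim(1) n1 by (intro mult_strict_right_mono)
    finally have "c * r ^ j * ?n * (real j + 1) * L < ?n * (q / 2)" by (simp only: mult.commute)
    moreover have "- ln a0 < ?n * (q / 2)"
      using elim(2) mult_right_mono[OF n, of "q / 2"] q by linarith
    moreover have "ln (a0 * a1 ^ (D ^ (4 * j))) = ln a0 + ?n * (q / 2) + ?n * (q / 2)"
      using assms by (simp add: ln_mult ln_realpow q_def)
    ultimately show ?case by linarith
  qed
qed

section \<open>Changing generators, and the theorem\<close>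

context group
begin

lemma word_value_closed: "w \<in> lists (carrier G) \<Longrightarrow> word_value G w \<in> carrier G"
  by (induction w) (auto simp: word_value_def)

lemma word_value_append:
  assumes "v \<in> lists (carrier G)" "w \<in> lists (carrier G)"
  shows "word_value G (v @ w) = word_value G v \<otimes> word_value G w"
  using assms(1)
proof (induction v)
  case Nil
  then show ?case using word_value_closed[OF assms(2)] by (simp add: word_value_def)
next
  case (Cons x v)
  then show ?case
    using word_value_closed[OF assms(2)] word_value_closed[of v] by (simp add: word_value_def m_assoc)
qed

text \<open>Translating generator by generator distorts length by a constant factor. The extra \<open>Suc\<close> pays
for a nonempty word that represents the identity.\<close>

lemma translate_words:
  assumes gens: "finite gens" "gens \<subseteq> carrier G" and X: "semigroup_generates G X"
  obtains c :: nat where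
    "\<And>w. w \<in> lists gens \<Longrightarrow>
      (\<exists>w'\<in>lists X. w' \<noteq> [] \<and> length w' \<le> c * Suc (length w) \<and> word_value G w' = word_value G w) \<and>
      (\<exists>w'\<in>lists X. w' \<noteq> [] \<and> length w' \<le> c * Suc (length w) \<and> word_value G w' = inv (word_value G w))"
proof -
  define F where "F = insert \<one> (gens \<union> m_inv G ` gens)"
  have F: "finite F" "F \<subseteq> carrier G" using gens by (auto simp: F_def)
  then have "\<forall>f\<in>F. \<exists>w\<in>lists X. w \<noteq> [] \<and> word_value G w = f"
    using X by (auto simp: semigroup_generates_def)
  then obtain t where t: "\<And>f. f \<in> F \<Longrightarrow> t f \<in> lists X \<and> t f \<noteq> [] \<and> word_value G (t f) = f"
    by metis
  define c where "c = (\<Sum>f\<in>F. length (t f))"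
  have c: "length (t f) \<le> c" if "f \<in> F" for f
    unfolding c_def using F(1) that by (intro member_le_sum) auto
  have XG: "lists X \<subseteq> lists (carrier G)" using X by (intro lists_mono) (simp add: semigroup_generates_def)
  have "(\<exists>w'\<in>lists X. w' \<noteq> [] \<and> length w' \<le> c * Suc (length w) \<and> word_value G w' = word_value G w) \<and>
      (\<exists>w'\<in>lists X. w' \<noteq> [] \<and> length w' \<le> c * Suc (length w) \<and> word_value G w' = inv (word_value G w))"
    if "w \<in> lists gens" for w
    using that
  proof (induction w)
    case Nil
    have "\<one> \<in> F" by (simp add: F_def)
    note o = t[OF this] c[OF this]
    have "inv (word_value G []) = \<one>" by (simp add: word_value_def)
    moreover have "word_value G [] = \<one>" by (simp add: word_value_def)
    ultimately show ?case using o by (metis list.size(3) mult.right_neutral One_nat_def)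
  next
    case (Cons s w)
    then obtain a b where a: "a \<in> lists X" "length a \<le> c * Suc (length w)" "word_value G a = word_value G w"
      and b: "b \<in> lists X" "length b \<le> c * Suc (length w)" "word_value G b = inv (word_value G w)"
      by blast
    have s: "s \<in> F" "inv s \<in> F" "s \<in> carrier G" using Cons.hyps gens(2) by (auto simp: F_def)
    have w: "word_value G w \<in> carrier G"
      using Cons.hyps gens(2) by (intro word_value_closed) (metis in_mono lists_mono)
    have v: "word_value G (s # w) = s \<otimes> word_value G w" by (simp add: word_value_def)
    have "word_value G (t s @ a) = word_value G (s # w)"
      using word_value_append[of "t s" a] t[OF s(1)] a XG v by auto
    moreover have "word_value G (b @ t (inv s)) = inv (word_value G (s # w))"
      using word_value_append[of b "t (inv s)"] t[OF s(2)] b XG v s w by (auto simp: inv_mult_group)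
    moreover have "length (t s @ a) \<le> c * Suc (length (s # w))" "length (b @ t (inv s)) \<le> c * Suc (length (s # w))"
      using c[OF s(1)] c[OF s(2)] a(2) b(2) by auto
    moreover have "t s @ a \<in> lists X" "b @ t (inv s) \<in> lists X" "t s @ a \<noteq> []" "b @ t (inv s) \<noteq> []"
      using t[OF s(1)] t[OF s(2)] a b by auto
    ultimately show ?case by blast
  qed
  then show thesis by (rule that)
qed

end

theorem theorem2:
  fixes G :: "('a, 'm) monoid_scheme"
    and gens :: "'a set"
    and S1 S2 :: "nat \<Rightarrow> 'a set"
  assumes "group G"
    and "finite gens"
    and "semigroup_generates G gens"
    and "\<And>n. S1 n \<subseteq> carrier G"
    and "\<And>n. S2 n \<subseteq> carrier G"
    and "\<And>n g. g \<in> S1 n \<Longrightarrow> \<exists>w \<in> lists gens. length w \<le> n \<and> word_value G w = g"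
    and "\<And>n g. g \<in> S2 n \<Longrightarrow> \<exists>w \<in> lists gens. length w \<le> n \<and> word_value G w = g"
    and "\<exists>\<alpha>\<^sub>0 \<alpha>\<^sub>1 \<alpha>\<^sub>2 :: real. \<alpha>\<^sub>0 > 0 \<and> \<alpha>\<^sub>1 > 1 \<and> \<alpha>\<^sub>2 > 0 \<and>
           (\<forall>\<^sub>F n in sequentially.
              real (card (S1 n)) \<ge> \<alpha>\<^sub>0 * \<alpha>\<^sub>1 ^ n \<and> real (card (S2 n)) \<ge> \<alpha>\<^sub>2 * real n)"
    and "\<And>n g h. g \<in> S1 n \<Longrightarrow> h \<in> S2 n \<Longrightarrow> g \<otimes>\<^bsub>G\<^esub> h = h \<otimes>\<^bsub>G\<^esub> g"
  shows "\<forall>X. finite X \<and> semigroup_generates G X \<longrightarrow> \<not> has_nca_over G X"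
proof (intro allI impI notI)
  fix X
  assume X: "finite X \<and> semigroup_generates G X" and "has_nca_over G X"
  then obtain A :: "('a + nat) set" and R where nca: "nca (Inl ` X) A R"
    and lang: "nca_language (Inl ` X) R = map Inl ` word_problem G X"
    unfolding has_nca_over_def by blast
  interpret group G by fact
  interpret nca "Inl ` X" A R by fact
  define V where "V = (\<Sum>\<rho>\<in>R. length (lhs \<rho>))"
  have XG: "X \<subseteq> carrier G" using X by (simp add: semigroup_generates_def)
  have proj: "map projl (map (Inl :: 'a \<Rightarrow> 'a + nat) w) = w" for w by (simp add: comp_def)
  have inl: "w \<in> lists (Inl ` X) \<longleftrightarrow> (\<exists>v\<in>lists X. w = map Inl v)" for w :: "('a + nat) list"
    by (auto simp: lists_image)
  interpret cannon_group G "Inl ` X" A R projl V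
  proof unfold_locales
    show "projl x \<in> carrier G" if "x \<in> Inl ` X" for x :: "'a + nat" using that XG by auto
    show "length (lhs \<rho>) \<le> Suc V" if "\<rho> \<in> R" for \<rho>
      using member_le_sum[OF that, of "\<lambda>\<rho>. length (lhs \<rho>)"] finite_rules by (simp add: V_def)
    show "(nca_step R)\<^sup>*\<^sup>* w [] \<longleftrightarrow> word_value G (map projl w) = \<one>\<^bsub>G\<^esub>" if w: "w \<in> lists (Inl ` X)" for w
    proof -
      obtain v where v: "v \<in> lists X" "w = map Inl v" using w inl by blast
      have "(nca_step R)\<^sup>*\<^sup>* w [] \<longleftrightarrow> w \<in> nca_language (Inl ` X) R" using w by (simp add: nca_language_def)
      also have "\<dots> \<longleftrightarrow> v \<in> word_problem G X"
        unfolding lang v(2) by (rule inj_image_mem_iff) (simp add: inj_mapI)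
      also have "\<dots> \<longleftrightarrow> word_value G (map projl w) = \<one>\<^bsub>G\<^esub>"
        using v(1) unfolding v(2) proj by (simp add: word_problem_def)
      finally show ?thesis .
    qed
  qed
  have gensG: "gens \<subseteq> carrier G" using assms(3) by (simp add: semigroup_generates_def)
  obtain c where c: "\<And>w. w \<in> lists gens \<Longrightarrow>
      (\<exists>w'\<in>lists X. w' \<noteq> [] \<and> length w' \<le> c * Suc (length w) \<and> word_value G w' = word_value G w) \<and>
      (\<exists>w'\<in>lists X. w' \<noteq> [] \<and> length w' \<le> c * Suc (length w) \<and> word_value G w' = inv\<^bsub>G\<^esub> (word_value G w))"
    using translate_words[OF assms(2) gensG] X by metis
  \<comment> \<open>For \<open>n \<ge> 1\<close> this absorbs the additive constant in the lengths of the translated words.\<close>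
  define C where "C = Suc (2 * c)"
  have rep: "representable (C * n) g \<and> representable (C * n) (inv\<^bsub>G\<^esub> g)"
    if g: "g \<in> S1 n \<union> S2 n" and n: "n \<ge> 1" for g n
  proof -
    obtain w where w: "w \<in> lists gens" "length w \<le> n" "word_value G w = g"
      using assms(6)[of g n] assms(7)[of g n] g by blast
    have "Suc (length w) \<le> 2 * n" using w(2) n by simp
    then have "c * Suc (length w) \<le> c * (2 * n)" by (rule mult_le_mono2)
    then have len: "c * Suc (length w) \<le> C * n" by (simp add: C_def)
    have "representable (C * n) e" if "v \<in> lists X" "v \<noteq> []" "length v \<le> c * Suc (length w)" "word_value G v = e" for v e
      unfolding representable_def val_def
      using that len inl proj by (intro bexI[of _ "map Inl v"]) auto
    then show ?thesis using c[OF w(1)] w(3) by blast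
  qed
  obtain a0 a1 a2 :: real where pos: "a0 > 0" "a1 > 1" "a2 > 0"
    and ev: "\<forall>\<^sub>F n in sequentially. real (card (S1 n)) \<ge> a0 * a1 ^ n \<and> real (card (S2 n)) \<ge> a2 * real n"
    using assms(8) by blast
  have C1: "C \<ge> 1" by (simp add: C_def)
  obtain b r E :: real and D :: nat where br: "0 \<le> b" "0 \<le> r" "r < 1" "1 \<le> E" "2 \<le> D"
    and bound: "\<forall>j S H. S \<subseteq> carrier G \<and> S \<noteq> {} \<and> finite H \<and> H \<noteq> {} \<and> H \<subseteq> carrier G \<and>
      (\<forall>g \<in> S \<union> H. representable (C * D ^ (4 * j)) g \<and> representable (C * D ^ (4 * j)) (inv\<^bsub>G\<^esub> g)) \<and>
      (\<forall>g \<in> S. \<forall>h \<in> H. g \<otimes>\<^bsub>G\<^esub> h = h \<otimes>\<^bsub>G\<^esub> g) \<and>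
      a2 * D ^ (4 * j) \<le> card H \<and> card H \<le> a2 * D ^ (4 * j) + 1 \<longrightarrow>
      ln (card S) \<le> b * r ^ j * D ^ (4 * j) * (real j + 1) * ln E"
    by (rule log_card_bound[OF C1 pos(3)])
  have "filterlim (\<lambda>j. D ^ (4 * j)) at_top sequentially"
  proof (rule filterlim_at_top_mono[OF filterlim_ident])
    have "j \<le> D ^ (4 * j)" for j
      using power_gt_expt[of D "4 * j"] br(5) by linarith
    then show "\<forall>\<^sub>F j in sequentially. j \<le> D ^ (4 * j)" by simp
  qed
  from eventually_compose_filterlim[OF ev this] subexponential_loses[OF pos(1,2) br(2,3,5), of b "ln E"]
  have "\<forall>\<^sub>F j in sequentially. (real (card (S1 (D ^ (4 * j)))) \<ge> a0 * a1 ^ (D ^ (4 * j)) \<and>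
      real (card (S2 (D ^ (4 * j)))) \<ge> a2 * real (D ^ (4 * j))) \<and>
      b * r ^ j * D ^ (4 * j) * (real j + 1) * ln E < ln (a0 * a1 ^ (D ^ (4 * j)))"
    by (rule eventually_conj)
  then obtain j where j: "real (card (S1 (D ^ (4 * j)))) \<ge> a0 * a1 ^ (D ^ (4 * j))"
      "real (card (S2 (D ^ (4 * j)))) \<ge> a2 * real (D ^ (4 * j))"
      "b * r ^ j * D ^ (4 * j) * (real j + 1) * ln E < ln (a0 * a1 ^ (D ^ (4 * j)))"
    by (metis (mono_tags, lifting) eventually_happens trivial_limit_sequentially)
  define n where "n = D ^ (4 * j)"
  have n: "n \<ge> 1" using br(5) by (simp add: n_def)
  have "nat \<lceil>a2 * real n\<rceil> \<le> card (S2 n)" using j(2) by (simp add: n_def nat_le_iff ceiling_le_iff)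
  then obtain H where H: "H \<subseteq> S2 n" "card H = nat \<lceil>a2 * real n\<rceil>" "finite H"
    by (rule obtain_subset_with_card_n)
  have "0 < a2 * real n" using pos(3) n by simp
  then have cH: "a2 * real n \<le> card H" "card H \<le> a2 * real n + 1" "0 < card H"
    using H(2) by linarith+
  have lower: "0 < a0 * a1 ^ n" using pos by simp
  then have "0 < real (card (S1 n))" using j(1) unfolding n_def by linarith
  then have S1: "S1 n \<noteq> {}" by auto
  have "ln (card (S1 n)) \<le> b * r ^ j * D ^ (4 * j) * (real j + 1) * ln E"
  proof (rule bound[rule_format], intro conjI ballI)
    show "H \<noteq> {}" using cH(3) by auto
    show "H \<subseteq> carrier G" using H(1) assms(5) by blast
    show "representable (C * D ^ (4 * j)) g" "representable (C * D ^ (4 * j)) (inv\<^bsub>G\<^esub> g)"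
      if "g \<in> S1 n \<union> H" for g
      using rep[OF _ n, of g] that H(1) unfolding n_def by blast+
    show "g \<otimes>\<^bsub>G\<^esub> h = h \<otimes>\<^bsub>G\<^esub> g" if "g \<in> S1 n" "h \<in> H" for g h
      using assms(9) that H(1) by blast
    show "a2 * D ^ (4 * j) \<le> card H" "card H \<le> a2 * D ^ (4 * j) + 1"
      using cH unfolding n_def by simp_all
  qed (use S1 assms(4) H in auto)
  moreover have "ln (a0 * a1 ^ n) \<le> ln (card (S1 n))"
    using lower j(1) unfolding n_def by (intro ln_mono) auto
  ultimately show False using j(3) unfolding n_def by linarith
qed

end
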